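(* For every oriented link $L$ in $S^3$, \[ V_{1,L}(t_0,t_1)=\mathrm{LG}_L(t_0,t_1)\in\mathbb{Z}[t_0^{\pm1},t_1^{\pm1}]. \]
   Context: Braid group conventions: $B_n$ is the Artin braid group with standard generators $s_1,\dots,s_{n-1}$ (relations $s_is_{i+1}s_i=s_{i+1}s_is_{i+1}$ and $s_is_j=s_js_i$ for $|i-j|\ge2$). Here $s_i$ is the crossing in which strand $i$ passes over strand $i+1$, and $\overline{s}_i=s_i^{-1}$. Link invariants from enhanced $R$-matrices: let $U$ be a finite-dimensional vector space with ordered basis $(u_1,\dots,u_m)$, write $u_{ij}=u_i\otimes u_j$, let $R\in\mathrm{End}(U\otimes U)$ be an invertible solution of the braid (Yang–Baxter) relation, and let $h\in\mathrm{End}(U)$. Let $\rho_R:B_n\to GL(U^{\otimes n})$ send $s_i\mapsto \mathrm{id}^{\otimes(i-1)}\otimes R\otimes\mathrm{id}^{\otimes(n-i-1)}$. If the oriented link $L$ is the closure of $\beta\in B_n$, its invariant is \[ \frac{1}{\dim U}\,\mathrm{tr}\big((\mathrm{id}_U\otimes h^{\otimes(n-1)})\circ\rho_R(\beta)\big), \] which (for the pairs $(R,h)$ below) depends only on the oriented link $L$. The Links--Gould invariant $\mathrm{LG}_L(t_0,t_1)$ is obtained from $U=W$ with basis $(w_1,w_2,w_3,w_4)$ over $\mathbb{Q}(t_0^{1/2},t_1^{1/2},Y)$, $Y=\sqrt{(t_0-1)(1-t_1)}$, with $h_{\mathrm{LG}}=\mathrm{diag}(t_0^{-1},-t_1,-t_0^{-1},t_1)$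 and $R_{\mathrm{LG}}$ given by: $R(w_{11})=t_0w_{11}$, $R(w_{12})=t_0^{1/2}w_{21}$, $R(w_{13})=t_0^{1/2}w_{31}$, $R(w_{14})=w_{41}$, $R(w_{21})=t_0^{1/2}w_{12}+(t_0-1)w_{21}$, $R(w_{22})=-w_{22}$, $R(w_{23})=(t_0t_1-1)w_{23}-t_0^{1/2}t_1^{1/2}w_{32}-t_0^{1/2}t_1^{1/2}Yw_{41}$, $R(w_{24})=t_1^{1/2}w_{42}$, $R(w_{31})=t_0^{1/2}w_{13}+(t_0-1)w_{31}$, $R(w_{32})=-t_0^{1/2}t_1^{1/2}w_{23}+Yw_{41}$, $R(w_{33})=-w_{33}$, $R(w_{34})=t_1^{1/2}w_{43}$, $R(w_{41})=w_{14}-t_0^{1/2}t_1^{1/2}Yw_{23}+Yw_{32}+Y^2w_{41}$, $R(w_{42})=t_1^{1/2}w_{24}+(t_1-1)w_{42}$, $R(w_{43})=t_1^{1/2}w_{34}+(t_1-1)w_{43}$, $R(w_{44})=t_1w_{44}$. The $V_1$-polynomial $V_{1,L}(t_0,t_1)$ is obtained from $U=V$ with basis $(v_1,v_2,v_3,v_4)$ over $\mathbb{Q}(t_0,t_1)$, with $h_V=\mathrm{diag}(-1,1,1,-1)$ and $R_V$ given by: $R(v_{11})=-v_{11}$, $R(v_{12})=-t_0v_{21}$, $R(v_{13})=-t_1v_{31}$, $R(v_{14})=-t_0t_1v_{41}$, $R(v_{21})=-v_{12}+(t_0-1)v_{21}$, $R(v_{22})=t_0v_{22}$, $R(v_{23})=-t_1v_{32}+(t_0-1)t_1v_{41}$,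 $R(v_{24})=t_0t_1v_{42}$, $R(v_{31})=-v_{13}+(t_1-1)v_{31}$, $R(v_{32})=-t_1^{-1}v_{23}+(1-t_0)v_{41}$, $R(v_{33})=t_1v_{33}$, $R(v_{34})=v_{43}$, $R(v_{41})=-v_{14}+(t_1^{-1}-1)v_{23}+(t_1-1)v_{32}+(t_0+t_1-2)v_{41}$, $R(v_{42})=t_1^{-1}v_{24}+(t_0-1)v_{42}$, $R(v_{43})=t_1v_{34}+(t_1-1)v_{43}$, $R(v_{44})=-v_{44}$. *)

theory Defs
  imports Main
begin

text \<open>Basis vectors of U are indexed 1..4.  An endomorphism of U (x) U is encoded as a
  function  R kl ij  = coefficient of u_kl in R(u_ij).  An R-matrix is given by listing,
  for each basis pair ij, the image R(u_ij) as a list of (basis pair, coefficient).\<close>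

definition coeff_of :: "(nat \<times> nat \<Rightarrow> ((nat \<times> nat) \<times> 'a::comm_monoid_add) list)
    \<Rightarrow> nat \<times> nat \<Rightarrow> nat \<times> nat \<Rightarrow> 'a" where
  "coeff_of img kl ij = sum_list (map snd (filter (\<lambda>p. fst p = kl) (img ij)))"

text \<open>Links--Gould R-matrix; a, b stand for t0^(1/2), t1^(1/2), and y for Y.\<close>
definition RLG_img :: "'a::field \<Rightarrow> 'a \<Rightarrow> 'a \<Rightarrow> nat \<times> nat \<Rightarrow> ((nat \<times> nat) \<times> 'a) list" where
  "RLG_img a b y ij = (let t0 = a^2; t1 = b^2 in
     if ij = (1,1) then [((1,1), t0)]
     else if ij = (1,2) then [((2,1), a)]
     else if ij = (1,3) then [((3,1), a)]
     else if ij = (1,4) then [((4,1), 1)]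
     else if ij = (2,1) then [((1,2), a), ((2,1), t0 - 1)]
     else if ij = (2,2) then [((2,2), -1)]
     else if ij = (2,3) then [((2,3), t0*t1 - 1), ((3,2), - (a*b)), ((4,1), - (a*b*y))]
     else if ij = (2,4) then [((4,2), b)]
     else if ij = (3,1) then [((1,3), a), ((3,1), t0 - 1)]
     else if ij = (3,2) then [((2,3), - (a*b)), ((4,1), y)]
     else if ij = (3,3) then [((3,3), -1)]
     else if ij = (3,4) then [((4,3), b)]
     else if ij = (4,1) then [((1,4), 1), ((2,3), - (a*b*y)), ((3,2), y), ((4,1), y^2)]
     else if ij = (4,2) then [((2,4), b), ((4,2), t1 - 1)]
     else if ij = (4,3) then [((3,4), b), ((4,3), t1 - 1)]
     else if ij = (4,4) then [((4,4), t1)]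
     else [])"

definition hLG :: "'a::field \<Rightarrow> 'a \<Rightarrow> nat \<Rightarrow> 'a" where
  "hLG a b i = (let t0 = a^2; t1 = b^2 in
     if i = 1 then inverse t0 else if i = 2 then - t1 else if i = 3 then - inverse t0
     else if i = 4 then t1 else 0)"

definition RV_img :: "'a::field \<Rightarrow> 'a \<Rightarrow> nat \<times> nat \<Rightarrow> ((nat \<times> nat) \<times> 'a) list" where
  "RV_img t0 t1 ij =
     (if ij = (1,1) then [((1,1), -1)]
     else if ij = (1,2) then [((2,1), - t0)]
     else if ij = (1,3) then [((3,1), - t1)]
     else if ij = (1,4) then [((4,1), - (t0*t1))]
     else if ij = (2,1) then [((1,2), -1), ((2,1), t0 - 1)]
     else if ij = (2,2) then [((2,2), t0)]
     else if ij = (2,3) then [((3,2), - t1), ((4,1), (t0 - 1)*t1)]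
     else if ij = (2,4) then [((4,2), t0*t1)]
     else if ij = (3,1) then [((1,3), -1), ((3,1), t1 - 1)]
     else if ij = (3,2) then [((2,3), - inverse t1), ((4,1), 1 - t0)]
     else if ij = (3,3) then [((3,3), t1)]
     else if ij = (3,4) then [((4,3), 1)]
     else if ij = (4,1) then [((1,4), -1), ((2,3), inverse t1 - 1), ((3,2), t1 - 1),
                              ((4,1), t0 + t1 - 2)]
     else if ij = (4,2) then [((2,4), inverse t1), ((4,2), t0 - 1)]
     else if ij = (4,3) then [((3,4), t1), ((4,3), t1 - 1)]
     else if ij = (4,4) then [((4,4), -1)]
     else [])"

definition hV :: "nat \<Rightarrow> 'a::field" where
  "hV i = (if i = 1 then -1 else if i = 2 then 1 else if i = 3 then 1 else if i = 4 then -1 else 0)"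

definition pairs4 :: "(nat \<times> nat) set" where
  "pairs4 = {1..4} \<times> {1..4}"

definition is_inverse4 :: "(nat \<times> nat \<Rightarrow> nat \<times> nat \<Rightarrow> 'a::field) \<Rightarrow> (nat \<times> nat \<Rightarrow> nat \<times> nat \<Rightarrow> 'a) \<Rightarrow> bool" where
  "is_inverse4 R M \<longleftrightarrow>
     (\<forall>kl ij. kl \<notin> pairs4 \<or> ij \<notin> pairs4 \<longrightarrow> M kl ij = 0) \<and>
     (\<forall>kl\<in>pairs4. \<forall>ij\<in>pairs4.
        (\<Sum>ab\<in>pairs4. M kl ab * R ab ij) = (if kl = ij then 1 else 0) \<and>
        (\<Sum>ab\<in>pairs4. R kl ab * M ab ij) = (if kl = ij then 1 else 0))"

definition Rinv4 :: "(nat \<times> nat \<Rightarrow> nat \<times> nat \<Rightarrow> 'a::field) \<Rightarrow> (nat \<times> nat \<Rightarrow> nat \<times> nat \<Rightarrow> 'a)" where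
  "Rinv4 R = (THE M. is_inverse4 R M)"

text \<open>Basis of U^(x)n: words of length n over {1..4}; operators are matrices indexed by them:
  A ys xs = coefficient of e_ys in A(e_xs).\<close>
definition tbasis :: "nat \<Rightarrow> nat list set" where
  "tbasis n = {xs. length xs = n \<and> set xs \<subseteq> {1..4}}"

definition tmul :: "nat \<Rightarrow> (nat list \<Rightarrow> nat list \<Rightarrow> 'a::field) \<Rightarrow> (nat list \<Rightarrow> nat list \<Rightarrow> 'a)
    \<Rightarrow> nat list \<Rightarrow> nat list \<Rightarrow> 'a" where
  "tmul n A B = (\<lambda>ys xs. \<Sum>zs\<in>tbasis n. A ys zs * B zs xs)"

definition tid :: "nat list \<Rightarrow> nat list \<Rightarrow> 'a::field" where
  "tid = (\<lambda>ys xs. if ys = xs then 1 else 0)"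

text \<open>id^(i-1) (x) R (x) id^(n-i-1), acting on tensor positions i, i+1 (1-based).\<close>
definition gen_op :: "(nat \<times> nat \<Rightarrow> nat \<times> nat \<Rightarrow> 'a::field) \<Rightarrow> nat \<Rightarrow> nat
    \<Rightarrow> nat list \<Rightarrow> nat list \<Rightarrow> 'a" where
  "gen_op R n i = (\<lambda>ys xs.
     if (\<forall>p<n. p \<noteq> i - 1 \<and> p \<noteq> i \<longrightarrow> ys ! p = xs ! p)
     then R (ys ! (i - 1), ys ! i) (xs ! (i - 1), xs ! i) else 0)"

text \<open>Braid words: an integer k > 0 stands for s_k, k < 0 for the inverse of s_(-k).\<close>
definition braid_word :: "nat \<Rightarrow> int list \<Rightarrow> bool" where
  "braid_word n w \<longleftrightarrow> (\<forall>g\<in>set w. g \<noteq> 0 \<and> nat \<bar>g\<bar> < n)"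

definition rho :: "(nat \<times> nat \<Rightarrow> nat \<times> nat \<Rightarrow> 'a::field) \<Rightarrow> nat \<Rightarrow> int list
    \<Rightarrow> nat list \<Rightarrow> nat list \<Rightarrow> 'a" where
  "rho R n w = foldr (\<lambda>g M. tmul n (gen_op (if g > 0 then R else Rinv4 R) n (nat \<bar>g\<bar>)) M) w tid"

text \<open>(1/dim U) tr((id (x) h^(n-1)) o rho(beta)), h diagonal.\<close>
definition braid_invariant :: "(nat \<times> nat \<Rightarrow> nat \<times> nat \<Rightarrow> 'a::field) \<Rightarrow> (nat \<Rightarrow> 'a)
    \<Rightarrow> nat \<Rightarrow> int list \<Rightarrow> 'a" where
  "braid_invariant R h n w =
     (\<Sum>xs\<in>tbasis n. (\<Prod>p\<in>{1..<n}. h (xs ! p)) * rho R n w xs xs) / 4"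

definition LG_inv :: "'a::field \<Rightarrow> 'a \<Rightarrow> 'a \<Rightarrow> nat \<Rightarrow> int list \<Rightarrow> 'a" where
  "LG_inv a b y n w = braid_invariant (coeff_of (RLG_img a b y)) (hLG a b) n w"

definition V1_inv :: "'a::field \<Rightarrow> 'a \<Rightarrow> nat \<Rightarrow> int list \<Rightarrow> 'a" where
  "V1_inv t0 t1 n w = braid_invariant (coeff_of (RV_img t0 t1)) hV n w"

end

theory Submission
  imports Defs
begin

text \<open>
  Write \<open>s = t\<^sub>0\<close>, \<open>t = t\<^sub>1\<close> and identify \<open>v\<^sub>1, v\<^sub>2, v\<^sub>3, v\<^sub>4\<close> with \<open>w\<^sub>3, w\<^sub>1, w\<^sub>4, w\<^sub>2\<close>. The two
  R-matrices are related by the odd reflection that connects the two Dynkin diagrams of \<open>sl(2|1)\<close>.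
  Let \<open>f : v\<^sub>1 \<mapsto> v\<^sub>2, v\<^sub>3 \<mapsto> v\<^sub>4\<close> and \<open>e : v\<^sub>2 \<mapsto> (1 - s) v\<^sub>1, v\<^sub>4 \<mapsto> (1 - t\<^sup>-\<^sup>1) v\<^sub>3\<close>, let
  \<open>k = diag(1,-1,1,-1)\<close>, \<open>g = diag(s,s,t\<^sup>-\<^sup>1,t\<^sup>-\<^sup>1)\<close>, and put \<open>F = 1 + f \<otimes> e\<close>. Up to a diagonal gauge
  transformation, which removes the square roots, \<open>F\<^sup>-\<^sup>1 R\<^sub>V F\<close> is \<open>R\<^sub>L\<^sub>G\<close>. This twisted matrix commutes
  with \<open>\<Delta>e = e \<otimes> 1 + k \<otimes> e\<close> and \<open>\<Delta>f = f \<otimes> g + k \<otimes> f\<close>. If \<open>\<epsilon>\<close> and \<open>\<phi>\<close> are the iterated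
  coproducts on \<open>n\<close> strands and \<open>G = g \<otimes> \<dots> \<otimes> g\<close>, then \<open>\<epsilon>\<^sup>2 = 0\<close> and \<open>\<epsilon>\<phi> + \<phi>\<epsilon> = 1 - G\<close>, and the operators
  \<open>J\<^sub>n\<^sub>+\<^sub>1 = (1 \<otimes> J\<^sub>n)(1 + f \<otimes> \<epsilon>)\<close> intertwine the two braid group representations.

  The weights \<open>h\<close> do not match under this conjugation, \<open>h\<^sub>L\<^sub>G = h\<^sub>V g\<^sup>-\<^sup>1\<close>, but the partial traces do. For
  \<open>A\<close> commuting with \<open>\<phi>\<close> the block \<open>A\<^sub>x\<^sub>,\<^sub>x\<^sub>+\<^sub>1\<close> is the commutator of \<open>\<phi>\<close> with a diagonal block times
  \<open>G\<^sup>-\<^sup>1\<close>; since \<open>h\<^sub>V\<close> anticommutes with \<open>\<epsilon>\<close> and \<open>\<phi>\<close>, cyclicity of the trace and \<open>\<epsilon>\<phi> + \<phi>\<epsilon> = 1 - G\<close>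
  turn \<open>h\<^sub>V\<close> into \<open>h\<^sub>V G\<^sup>-\<^sup>1\<close>.

  Two further operators commuting with \<open>R\<^sub>V\<close> show that the partial trace for \<open>R\<^sub>V\<close> is a scalar matrix.
  The invariant is therefore one diagonal entry, and the division by \<open>dim V = 4\<close> does no harm to
  integrality.
\<close>

section \<open>Operators on words\<close>

lemma finite_tbasis [simp]: "finite (tbasis n)"
  using finite_lists_length_eq [of "{1..4::nat}" n] by (simp add: tbasis_def conj_commute)

lemma tbasis_0: "tbasis 0 = {[]}"
  by (auto simp: tbasis_def)

definition letters :: "nat set" where
  "letters = {1..4}"

lemma Cons_in_tbasis: "x # xs \<in> tbasis (Suc n) \<longleftrightarrow> x \<in> letters \<and> xs \<in> tbasis n"
  by (auto simp: tbasis_def letters_def)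

lemma sum_tbasis_Suc:
  "(\<Sum>xs\<in>tbasis (Suc n). F xs) = (\<Sum>x\<in>letters. \<Sum>xs\<in>tbasis n. F (x # xs))"
proof -
  have "tbasis (Suc n) = (\<lambda>(x, xs). x # xs) ` (letters \<times> tbasis n)"
    by (auto simp: tbasis_def letters_def length_Suc_conv image_iff)
  moreover have "inj_on (\<lambda>(x, xs). x # xs) (letters \<times> tbasis n)"
    by (auto simp: inj_on_def)
  ultimately show ?thesis
    by (simp add: sum.reindex sum.cartesian_product case_prod_unfold)
qed

lemma sum_letters: "(\<Sum>x\<in>letters. F x) = F 1 + F 2 + F 3 + F 4"
  by (simp add: letters_def numeral_eq_Suc add.assoc)

lemma letter_cases: "(x::nat) \<in> letters \<longleftrightarrow> x = 1 \<or> x = 2 \<or> x = 3 \<or> x = 4"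
  by (auto simp: letters_def)

lemma numeral_in_letters [simp]:
  "Suc 0 \<in> letters" "1 \<in> letters" "2 \<in> letters" "3 \<in> letters" "4 \<in> letters"
  by (simp_all add: letters_def)

text \<open>Length-preserving matrices on words of all lengths at once: families indexed by the number of strands,
  such as iterated coproducts, become single elements of one ring.\<close>

typedef (overloaded) 'a op = "{A :: nat list \<Rightarrow> nat list \<Rightarrow> 'a::field.
    \<forall>ys xs. A ys xs \<noteq> 0 \<longrightarrow> ys \<in> tbasis (length xs) \<and> xs \<in> tbasis (length xs)}"
  morphisms ent Abs_op
  by (rule exI [of _ "\<lambda>_ _. 0"]) simp

setup_lifting type_definition_op

lemma op_eqI: "(\<And>ys xs. ent A ys xs = ent B ys xs) \<Longrightarrow> A = B"
  by transfer blast

lemma ent_zero: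
  "length ys \<noteq> length xs \<Longrightarrow> ent A ys xs = 0"
  "ys \<notin> tbasis (length xs) \<Longrightarrow> ent A ys xs = 0"
  "xs \<notin> tbasis (length xs) \<Longrightarrow> ent A ys xs = 0"
  by (transfer; force simp: tbasis_def)+

lemma ent_Nil_Cons [simp]: "ent A [] (x # xs) = 0" "ent A (x # xs) [] = 0"
  by (simp_all add: ent_zero)

instantiation op :: (field) ring_1
begin

lift_definition zero_op :: "'a op" is "\<lambda>_ _. 0" by simp
lift_definition one_op :: "'a op" is "\<lambda>ys xs. if ys = xs \<and> xs \<in> tbasis (length xs) then 1 else 0"
  by (auto split: if_splits)
lift_definition plus_op :: "'a op \<Rightarrow> 'a op \<Rightarrow> 'a op" is "\<lambda>A B ys xs. A ys xs + B ys xs"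
  by (metis add_cancel_right_left)
lift_definition minus_op :: "'a op \<Rightarrow> 'a op \<Rightarrow> 'a op" is "\<lambda>A B ys xs. A ys xs - B ys xs"
  by (metis cancel_comm_monoid_add_class.diff_cancel)
lift_definition uminus_op :: "'a op \<Rightarrow> 'a op" is "\<lambda>A ys xs. - A ys xs" by simp
lift_definition times_op :: "'a op \<Rightarrow> 'a op \<Rightarrow> 'a op" is
  "\<lambda>A B ys xs. \<Sum>zs\<in>tbasis (length xs). A ys zs * B zs xs"
proof -
  fix A B :: "nat list \<Rightarrow> nat list \<Rightarrow> 'a" and ys xs
  assume A: "\<And>ys xs. A ys xs \<noteq> 0 \<Longrightarrow> ys \<in> tbasis (length xs) \<and> xs \<in> tbasis (length xs)"
    and B: "\<And>ys xs. B ys xs \<noteq> 0 \<Longrightarrow> ys \<in> tbasis (length xs) \<and> xs \<in> tbasis (length xs)"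
    and "(\<Sum>zs\<in>tbasis (length xs). A ys zs * B zs xs) \<noteq> 0"
  then obtain zs where "zs \<in> tbasis (length xs)" "A ys zs * B zs xs \<noteq> 0"
    by (meson sum.not_neutral_contains_not_neutral)
  moreover from this have "length zs = length xs" by (simp add: tbasis_def)
  ultimately show "ys \<in> tbasis (length xs) \<and> xs \<in> tbasis (length xs)"
    using A [of ys zs] B [of zs xs] by simp
qed

instance
proof
  fix A B C :: "'a op"
  show "A * B * C = A * (B * C)"
  proof (transfer, intro ext)
    fix A B C :: "nat list \<Rightarrow> nat list \<Rightarrow> 'a" and ys xs
    have "(\<Sum>zs\<in>tbasis (length xs). (\<Sum>us\<in>tbasis (length zs). A ys us * B us zs) * C zs xs)
        = (\<Sum>zs\<in>tbasis (length xs). \<Sum>us\<in>tbasis (length xs). A ys us * B us zs * C zs xs)"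
      by (intro sum.cong refl) (simp add: sum_distrib_right tbasis_def)
    also have "\<dots> = (\<Sum>us\<in>tbasis (length xs). \<Sum>zs\<in>tbasis (length xs). A ys us * B us zs * C zs xs)"
      by (rule sum.swap)
    also have "\<dots> = (\<Sum>us\<in>tbasis (length xs). A ys us * (\<Sum>zs\<in>tbasis (length xs). B us zs * C zs xs))"
      by (simp add: sum_distrib_left mult.assoc)
    finally show "(\<Sum>zs\<in>tbasis (length xs). (\<Sum>us\<in>tbasis (length zs). A ys us * B us zs) * C zs xs)
        = (\<Sum>us\<in>tbasis (length xs). A ys us * (\<Sum>zs\<in>tbasis (length xs). B us zs * C zs xs))" .
  qed
  show "1 * A = A"
  proof (transfer, intro ext)
    fix A :: "nat list \<Rightarrow> nat list \<Rightarrow> 'a" and ys xs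
    assume A: "\<forall>ys xs. A ys xs \<noteq> 0 \<longrightarrow> ys \<in> tbasis (length xs) \<and> xs \<in> tbasis (length xs)"
    have "(\<Sum>zs\<in>tbasis (length xs). (if ys = zs \<and> zs \<in> tbasis (length zs) then 1 else 0) * A zs xs)
        = (\<Sum>zs\<in>tbasis (length xs). if ys = zs then A ys xs else 0)"
      by (intro sum.cong refl) (auto simp: tbasis_def)
    then show "(\<Sum>zs\<in>tbasis (length xs). (if ys = zs \<and> zs \<in> tbasis (length zs) then 1 else 0) * A zs xs)
        = A ys xs"
      using A by auto
  qed
  show "A * 1 = A"
  proof (transfer, intro ext)
    fix A :: "nat list \<Rightarrow> nat list \<Rightarrow> 'a" and ys xs
    assume A: "\<forall>ys xs. A ys xs \<noteq> 0 \<longrightarrow> ys \<in> tbasis (length xs) \<and> xs \<in> tbasis (length xs)"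
    have "(\<Sum>zs\<in>tbasis (length xs). A ys zs * (if zs = xs \<and> xs \<in> tbasis (length xs) then 1 else 0))
        = (\<Sum>zs\<in>tbasis (length xs). if zs = xs then A ys xs else 0)"
      by (intro sum.cong refl) auto
    then show "(\<Sum>zs\<in>tbasis (length xs). A ys zs * (if zs = xs \<and> xs \<in> tbasis (length xs) then 1 else 0))
        = A ys xs"
      using A by auto
  qed
  show "(A + B) * C = A * C + B * C"
    by transfer (simp add: distrib_right sum.distrib)
  show "A * (B + C) = A * B + A * C"
    by transfer (simp add: distrib_left sum.distrib)
  show "(0::'a op) \<noteq> 1"
    by transfer (metis (mono_tags) length_0_conv singletonI tbasis_0 zero_neq_one)
  show "A + B + C = A + (B + C)" "A + B = B + A" "0 + A = A" "- A + A = 0" "A - B = A + - B"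
    by (transfer; simp add: fun_eq_iff algebra_simps)+
qed

end

lemma ent_ops [simp]:
  "ent 0 ys xs = 0"
  "ent (A + B) ys xs = ent A ys xs + ent B ys xs"
  "ent (A - B) ys xs = ent A ys xs - ent B ys xs"
  "ent (- A) ys xs = - ent A ys xs"
  by (transfer; simp)+

lemma ent_one: "ent 1 ys xs = (if ys = xs \<and> xs \<in> tbasis (length xs) then 1 else 0)"
  by transfer simp

lemma ent_times: "ent (A * B) ys xs = (\<Sum>zs\<in>tbasis (length xs). ent A ys zs * ent B zs xs)"
  by transfer simp

lift_definition smul :: "'a::field \<Rightarrow> 'a op \<Rightarrow> 'a op" is "\<lambda>c A ys xs. c * A ys xs" by force

lemma ent_smul [simp]: "ent (smul c A) ys xs = c * ent A ys xs"
  by transfer simp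

lemma smul_times [simp]: "smul c A * B = smul c (A * B)" "A * smul c B = smul c (A * B)"
  by (rule op_eqI; simp add: ent_times sum_distrib_left algebra_simps)+

lemma smul_simps [simp]:
  "smul 0 A = 0" "smul 1 A = A" "smul (- 1) A = - A" "smul c 0 = 0" "smul c (smul d A) = smul (c * d) A"
  by (rule op_eqI; simp)+

section \<open>The trace on words of a fixed length and its cyclicity\<close>

definition tr :: "nat \<Rightarrow> 'a::field op \<Rightarrow> 'a" where
  "tr n A = (\<Sum>xs\<in>tbasis n. ent A xs xs)"

lemma tr_times_commute: "tr n (A * B) = tr n (B * A)"
proof -
  have "tr n (A * B) = (\<Sum>xs\<in>tbasis n. \<Sum>zs\<in>tbasis n. ent A xs zs * ent B zs xs)"
    unfolding tr_def ent_times by (intro sum.cong refl) (auto simp: tbasis_def)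
  also have "\<dots> = (\<Sum>zs\<in>tbasis n. \<Sum>xs\<in>tbasis n. ent A xs zs * ent B zs xs)"
    by (rule sum.swap)
  also have "\<dots> = tr n (B * A)"
    unfolding tr_def ent_times by (intro sum.cong refl) (auto simp: tbasis_def mult.commute)
  finally show ?thesis .
qed

lemma tr_linear [simp]:
  "tr n 0 = 0" "tr n (A + B) = tr n A + tr n B" "tr n (A - B) = tr n A - tr n B"
  "tr n (- A) = - tr n A" "tr n (smul c A) = c * tr n A"
  by (simp_all add: tr_def sum.distrib sum_subtractf sum_negf sum_distrib_left)

section \<open>Splitting off the first strand\<close>

lift_definition emp :: "'a::field op" is "\<lambda>ys xs. if ys = [] \<and> xs = [] then 1 else 0"
  by (simp add: tbasis_0 split: if_splits)

lift_definition ten :: "(nat \<Rightarrow> nat \<Rightarrow> 'a::field) \<Rightarrow> 'a op \<Rightarrow> 'a op" is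
  "\<lambda>X A ys xs. case (ys, xs) of
     (y # ys', x # xs') \<Rightarrow> if y \<in> letters \<and> x \<in> letters then X y x * A ys' xs' else 0
   | _ \<Rightarrow> 0"
  by (auto split: list.splits if_splits simp: Cons_in_tbasis)

text \<open>A block at the first letters is itself an operator on the remaining strands. The
  weighted traces of the diagonal blocks are the diagonal entries of the partial trace that closes
  all strands but the first.\<close>

lift_definition blk :: "nat \<Rightarrow> nat \<Rightarrow> 'a::field op \<Rightarrow> 'a op" is
  "\<lambda>y x A ys xs. A (y # ys) (x # xs)"
  by (metis Cons_in_tbasis length_Cons)

lemma ent_emp: "ent emp ys xs = (if ys = [] \<and> xs = [] then 1 else 0)"
  by transfer simp

lemma ent_ten_simps [simp]:
  "ent (ten X A) [] xs = 0" "ent (ten X A) ys [] = 0"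
  "ent (ten X A) (y # ys) (x # xs) = (if y \<in> letters \<and> x \<in> letters then X y x * ent A ys xs else 0)"
  by (transfer; simp split: list.splits)+

lemma ent_blk [simp]: "ent (blk y x A) ys xs = ent A (y # ys) (x # xs)"
  by transfer simp

text \<open>The empty word and the sixteen blocks at the first letter determine an operator. Many
  identities below thereby reduce to identities between 4 by 4 letter matrices.\<close>

lemma op_eq_blkI:
  assumes "ent A [] [] = ent B [] []"
    and "\<And>y x. y \<in> letters \<Longrightarrow> x \<in> letters \<Longrightarrow> blk y x A = blk y x B"
  shows "A = B"
proof (rule op_eqI)
  fix ys xs
  show "ent A ys xs = ent B ys xs"
  proof (cases "ys \<in> tbasis (length xs) \<and> xs \<in> tbasis (length xs)")
    case True
    show ?thesis
    proof (cases xs)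
      case Nil
      then show ?thesis using True assms(1) by (simp add: tbasis_0)
    next
      case (Cons x xs')
      then obtain y ys' where ys: "ys = y # ys'"
        using True by (cases ys) (auto simp: tbasis_def)
      then show ?thesis
        using assms(2) [of y x] True Cons by (metis Cons_in_tbasis ent_blk length_Cons)
    qed
  next
    case False
    then show ?thesis by (metis ent_zero(2,3))
  qed
qed

lemma blk_simps [simp]:
  "blk y x (A + B) = blk y x A + blk y x B" "blk y x (A - B) = blk y x A - blk y x B"
  "blk y x (- A) = - blk y x A" "blk y x 0 = 0" "blk y x (smul c A) = smul c (blk y x A)" "blk y x emp = 0"
  by (rule op_eqI; simp add: ent_emp)+

lemma blk_ten [simp]: "y \<in> letters \<Longrightarrow> x \<in> letters \<Longrightarrow> blk y x (ten X A) = smul (X y x) A"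
  by (rule op_eqI) auto

lemma blk_one: "y \<in> letters \<Longrightarrow> x \<in> letters \<Longrightarrow> blk y x 1 = (if y = x then 1 else 0)"
  by (rule op_eqI) (auto simp: ent_one Cons_in_tbasis)

lemma blk_times: "blk y x (A * B) = (\<Sum>z\<in>letters. blk y z A * blk z x B)"
proof (rule op_eqI)
  fix ys xs
  have "ent (blk y x (A * B)) ys xs
      = (\<Sum>z\<in>letters. \<Sum>zs\<in>tbasis (length xs). ent A (y # ys) (z # zs) * ent B (z # zs) (x # xs))"
    by (simp add: ent_times sum_tbasis_Suc)
  also have "\<dots> = ent (\<Sum>z\<in>letters. blk y z A * blk z x B) ys xs"
    by (simp only: sum_letters) (simp add: ent_times)
  finally show "ent (blk y x (A * B)) ys xs = ent (\<Sum>z\<in>letters. blk y z A * blk z x B) ys xs" .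
qed

lemma ent_times_Nil [simp]: "ent (A * B) [] [] = ent A [] [] * ent B [] []"
  by (simp add: ent_times tbasis_0)

definition lmul :: "(nat \<Rightarrow> nat \<Rightarrow> 'a::field) \<Rightarrow> (nat \<Rightarrow> nat \<Rightarrow> 'a) \<Rightarrow> nat \<Rightarrow> nat \<Rightarrow> 'a" where
  "lmul X Y y x = (\<Sum>z\<in>letters. X y z * Y z x)"

definition lid :: "nat \<Rightarrow> nat \<Rightarrow> 'a::field" where
  "lid y x = (if y = x then 1 else 0)"

lemma ten_times_ten: "ten X A * ten Y B = ten (lmul X Y) (A * B)"
proof (rule op_eq_blkI, simp, rule op_eqI)
  fix y x :: nat and ys xs
  assume yx: "y \<in> letters" "x \<in> letters"
  show "ent (blk y x (ten X A * ten Y B)) ys xs = ent (blk y x (ten (lmul X Y) (A * B))) ys xs"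
    unfolding blk_times sum_letters using yx by (simp add: lmul_def sum_letters algebra_simps del: ent_blk)
qed

lemma emp_ten [simp]: "emp * ten X A = 0" "ten X A * emp = 0" "emp * emp = emp"
  by (rule op_eq_blkI; simp add: blk_times sum_letters ent_emp)+

text \<open>\<open>ten\<close> vanishes on the empty word, so the zero-strand component of an
  operator has to be supplied by \<open>emp\<close>.\<close>

lemma one_eq_emp_ten: "1 = emp + ten lid 1"
  by (rule op_eq_blkI) (auto simp: ent_emp ent_one tbasis_0 blk_one lid_def)

lemma ten_linear:
  "ten X (A + B) = ten X A + ten X B" "ten X (A - B) = ten X A - ten X B" "ten X 0 = 0"
  "ten X (- A) = - ten X A"
  by (rule op_eqI; rename_tac ys xs; case_tac ys; case_tac xs; simp add: algebra_simps)+

lemma ten_cong: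
  "(\<And>y x. y \<in> letters \<Longrightarrow> x \<in> letters \<Longrightarrow> X y x = Y y x) \<Longrightarrow> ten X A = ten Y A"
  by (rule op_eq_blkI) auto

lemma ten_add_left: "ten X A + ten Y A = ten (\<lambda>y x. X y x + Y y x) A"
  by (rule op_eqI; rename_tac ys xs; case_tac ys; case_tac xs; simp add: algebra_simps)

section \<open>Generators of the braid group\<close>

lemma pairs4_letters: "pairs4 = letters \<times> letters"
  by (simp add: pairs4_def letters_def)

lemma sum_pairs4: "(\<Sum>ab\<in>pairs4. F ab) = (\<Sum>a\<in>letters. \<Sum>b\<in>letters. F (a, b))"
  by (simp add: pairs4_letters sum.cartesian_product)

section \<open>Operators on the first two strands\<close>

lift_definition ten2 :: "(nat \<times> nat \<Rightarrow> nat \<times> nat \<Rightarrow> 'a::field) \<Rightarrow> 'a op \<Rightarrow> 'a op" is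
  "\<lambda>R A ys xs. case (ys, xs) of
     (y # y' # ys', x # x' # xs') \<Rightarrow>
       if (y, y') \<in> pairs4 \<and> (x, x') \<in> pairs4 then R (y, y') (x, x') * A ys' xs' else 0
   | _ \<Rightarrow> 0"
  by (auto split: list.splits if_splits simp: Cons_in_tbasis pairs4_letters)

lemma ent_ten2_simps [simp]:
  "ent (ten2 R A) [] xs = 0" "ent (ten2 R A) ys [] = 0" "ent (ten2 R A) [y] xs = 0" "ent (ten2 R A) ys [x] = 0"
  "ent (ten2 R A) (y # y' # ys) (x # x' # xs) =
     (if (y, y') \<in> pairs4 \<and> (x, x') \<in> pairs4 then R (y, y') (x, x') * ent A ys xs else 0)"
  by (transfer; simp split: list.splits)+

lemma blk_ten2 [simp]:
  "y \<in> letters \<Longrightarrow> x \<in> letters \<Longrightarrow> blk y x (ten2 R A) = ten (\<lambda>y' x'. R (y, y') (x, x')) A"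
proof (rule op_eqI)
  fix ys xs
  assume "y \<in> letters" "x \<in> letters"
  then show "ent (blk y x (ten2 R A)) ys xs = ent (ten (\<lambda>y' x'. R (y, y') (x, x')) A) ys xs"
    by (cases ys; cases xs) (auto simp: pairs4_letters)
qed

definition pmul :: "(nat \<times> nat \<Rightarrow> nat \<times> nat \<Rightarrow> 'a::field) \<Rightarrow> (nat \<times> nat \<Rightarrow> nat \<times> nat \<Rightarrow> 'a)
    \<Rightarrow> nat \<times> nat \<Rightarrow> nat \<times> nat \<Rightarrow> 'a" where
  "pmul R Q kl ij = (\<Sum>ab\<in>pairs4. R kl ab * Q ab ij)"

definition ptens :: "(nat \<Rightarrow> nat \<Rightarrow> 'a::field) \<Rightarrow> (nat \<Rightarrow> nat \<Rightarrow> 'a) \<Rightarrow> nat \<times> nat \<Rightarrow> nat \<times> nat \<Rightarrow> 'a" where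
  "ptens X Y kl ij = X (fst kl) (fst ij) * Y (snd kl) (snd ij)"

definition peq :: "(nat \<times> nat \<Rightarrow> nat \<times> nat \<Rightarrow> 'a::field) \<Rightarrow> (nat \<times> nat \<Rightarrow> nat \<times> nat \<Rightarrow> 'a) \<Rightarrow> bool" where
  "peq R Q \<longleftrightarrow> (\<forall>kl\<in>pairs4. \<forall>ij\<in>pairs4. R kl ij = Q kl ij)"

lemma ten2_cong: "peq R Q \<Longrightarrow> ten2 R A = ten2 Q A"
  by (rule op_eq_blkI) (auto intro!: ten_cong simp: peq_def pairs4_letters)

lemma ten_ten: "ten X (ten Y A) = ten2 (ptens X Y) A"
proof (rule op_eqI)
  fix ys xs
  show "ent (ten X (ten Y A)) ys xs = ent (ten2 (ptens X Y) A) ys xs"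
    by (cases ys; cases "tl ys"; cases xs; cases "tl xs")
      (auto simp: ptens_def pairs4_letters)
qed

lemma ten2_times_ten2: "ten2 R A * ten2 Q B = ten2 (pmul R Q) (A * B)"
proof (rule op_eq_blkI, simp)
  fix y x :: nat
  assume yx: "y \<in> letters" "x \<in> letters"
  show "blk y x (ten2 R A * ten2 Q B) = blk y x (ten2 (pmul R Q) (A * B))"
    unfolding blk_times sum_letters using yx
    by (simp add: ten_times_ten ten_add_left)
      (rule ten_cong, simp add: pmul_def sum_pairs4 lmul_def sum_letters algebra_simps)
qed

lemma ten_emp_ten2 [simp]:
  "ten X emp * ten2 R A = 0" "ten2 R A * ten X emp = 0" "emp * ten2 R A = 0" "ten2 R A * emp = 0"
  by (rule op_eq_blkI; simp add: blk_times sum_letters ent_emp)+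

lemma ten2_linear: "ten2 R (A + B) = ten2 R A + ten2 R B" "ten2 R 0 = 0"
  by (rule op_eq_blkI; simp add: ten_linear)+

lemma ten2_add_left: "ten2 R A + ten2 Q A = ten2 (\<lambda>kl ij. R kl ij + Q kl ij) A"
  by (rule op_eq_blkI) (simp_all add: ten_add_left)

text \<open>Inserts an idle first strand. The summand \<open>emp\<close> makes the shift unital and
  multiplicative on all word lengths, at the price of additivity.\<close>

definition sh :: "'a::field op \<Rightarrow> 'a op" where
  "sh A = emp + ten lid A"

lemma lmul_lid [simp]:
  "y \<in> letters \<Longrightarrow> x \<in> letters \<Longrightarrow> lmul lid X y x = X y x"
  "y \<in> letters \<Longrightarrow> x \<in> letters \<Longrightarrow> lmul X lid y x = X y x"
  by (auto simp: lmul_def lid_def sum_letters letter_cases)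

lemma ten_lmul_lid [simp]: "ten (lmul lid X) A = ten X A" "ten (lmul X lid) A = ten X A"
  by (rule ten_cong; simp)+

lemma sh_times_sh: "sh A * sh B = sh (A * B)"
  by (simp add: sh_def distrib_left distrib_right ten_times_ten)

lemma sh_one [simp]: "sh 1 = 1"
  by (simp add: sh_def one_eq_emp_ten [symmetric])

lemma sh_ten [simp]: "sh A * ten X B = ten X (A * B)" "ten X B * sh A = ten X (B * A)"
  by (simp_all add: sh_def distrib_left distrib_right ten_times_ten)

lemma blk_sh: "y \<in> letters \<Longrightarrow> x \<in> letters \<Longrightarrow> blk y x (sh A) = (if y = x then A else 0)"
  by (simp add: sh_def lid_def)

text \<open>The summands \<open>emp\<close> and \<open>ten lid emp\<close> give the identity on
  words of length 0 and 1, where there is no pair of strands. In this way an inverse matrix yields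
  an inverse in the ring of operators on all lengths.\<close>

definition pairop :: "(nat \<times> nat \<Rightarrow> nat \<times> nat \<Rightarrow> 'a::field) \<Rightarrow> 'a op" where
  "pairop R = emp + ten lid emp + ten2 R 1"

definition pid :: "nat \<times> nat \<Rightarrow> nat \<times> nat \<Rightarrow> 'a::field" where
  "pid kl ij = (if kl = ij then 1 else 0)"

lemma ptens_lid_lid: "ptens lid lid = pid"
  by (auto simp: fun_eq_iff ptens_def lid_def pid_def)

lemma pairop_pid: "pairop pid = 1"
proof -
  have "(1 :: 'a op) = emp + ten lid (emp + ten lid 1)"
    using one_eq_emp_ten by metis
  then show ?thesis
    by (simp add: pairop_def ten_linear ten_ten ptens_lid_lid add.assoc)
qed

lemma pairop_times_ten2: "pairop R * ten2 Q A = ten2 (pmul R Q) A" "ten2 Q A * pairop R = ten2 (pmul Q R) A"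
  by (simp_all add: pairop_def distrib_left distrib_right ten2_times_ten2)

lemma pairop_times_emp [simp]: "pairop R * emp = emp" "emp * pairop R = emp"
  by (simp_all add: pairop_def distrib_left distrib_right)

lemma pairop_times_ten_emp [simp]: "pairop R * ten X emp = ten X emp" "ten X emp * pairop R = ten X emp"
  by (simp_all add: pairop_def distrib_left distrib_right ten_times_ten)

lemma pairop_times_pairop: "pairop R * pairop Q = pairop (pmul R Q)"
  by (subst (2) pairop_def) (simp add: distrib_left pairop_times_ten2, simp add: pairop_def)

lemma pairop_inverse: "peq (pmul R M) pid \<Longrightarrow> pairop R * pairop M = 1"
  using ten2_cong [of "pmul R M" pid 1] pairop_pid
  by (simp add: pairop_times_pairop) (simp add: pairop_def)

definition genop :: "(nat \<times> nat \<Rightarrow> nat \<times> nat \<Rightarrow> 'a::field) \<Rightarrow> nat \<Rightarrow> 'a op" where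
  "genop R i = (sh ^^ (i - 1)) (pairop R)"

lemma genop_Suc: "i \<ge> 1 \<Longrightarrow> genop R (Suc i) = sh (genop R i)"
  by (cases i) (simp_all add: genop_def)

lemma genop_1: "genop R (Suc 0) = pairop R"
  by (simp add: genop_def)

lemma genop_inverse:
  assumes "peq (pmul R M) pid" "i \<ge> 1"
  shows "genop R i * genop M i = 1"
  using assms(2)
  by (induction i rule: dec_induct)
    (simp_all add: genop_1 genop_Suc pairop_inverse [OF assms(1)] sh_times_sh)

lemma tbasis_Suc_cases:
  assumes "xs \<in> tbasis (Suc n)"
  obtains x xs' where "xs = x # xs'" "x \<in> letters" "xs' \<in> tbasis n"
  using assms by (cases xs) (auto simp: Cons_in_tbasis, simp add: tbasis_def)

text \<open>Links the generators built by shifting to \<open>gen_op\<close>. The base case splits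
  off the two letters acted upon; each further step removes one idle letter and lowers the index by
  one.\<close>

lemma ent_genop:
  assumes "1 \<le> i" "i < n" "ys \<in> tbasis n" "xs \<in> tbasis n"
  shows "ent (genop R i) ys xs = gen_op R n i ys xs"
  using assms
proof (induction i arbitrary: n ys xs rule: dec_induct)
  case base
  then obtain m where n: "n = Suc (Suc m)" by (metis less_imp_Suc_add plus_1_eq_Suc add_Suc)
  from base n obtain x x' xs' y y' ys' where
    xs: "xs = x # x' # xs'" "x \<in> letters" "x' \<in> letters" "xs' \<in> tbasis m" and
    ys: "ys = y # y' # ys'" "y \<in> letters" "y' \<in> letters" "ys' \<in> tbasis m"
    by (metis tbasis_Suc_cases)
  have len: "length xs' = m" "length ys' = m" using xs ys by (auto simp: tbasis_def)
  have "(\<forall>p<n. p \<noteq> 0 \<and> p \<noteq> 1 \<longrightarrow> ys ! p = xs ! p) \<longleftrightarrow> ys' = xs'"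
  proof
    assume H: "\<forall>p<n. p \<noteq> 0 \<and> p \<noteq> 1 \<longrightarrow> ys ! p = xs ! p"
    show "ys' = xs'"
    proof (rule nth_equalityI)
      fix p assume "p < length ys'"
      then show "ys' ! p = xs' ! p"
        using H [rule_format, of "Suc (Suc p)"] n len xs(1) ys(1) by simp
    qed (simp add: len)
  next
    assume "ys' = xs'"
    then show "\<forall>p<n. p \<noteq> 0 \<and> p \<noteq> 1 \<longrightarrow> ys ! p = xs ! p"
      using xs(1) ys(1) by (auto simp: nth_Cons')
  qed
  then show ?case
    using xs ys len
    by (auto simp: genop_1 pairop_def gen_op_def ent_emp pairs4_letters ent_one)
next
  case (step i)
  then obtain m where n: "n = Suc m" by (metis less_imp_Suc_add)
  from step n obtain x xs' y ys' where
    xs: "xs = x # xs'" "x \<in> letters" "xs' \<in> tbasis m" and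
    ys: "ys = y # ys'" "y \<in> letters" "ys' \<in> tbasis m"
    by (metis tbasis_Suc_cases)
  have "(\<forall>p<n. p \<noteq> i \<and> p \<noteq> Suc i \<longrightarrow> ys ! p = xs ! p) \<longleftrightarrow>
      y = x \<and> (\<forall>p<m. p \<noteq> i - 1 \<and> p \<noteq> i \<longrightarrow> ys' ! p = xs' ! p)"
    (is "?L \<longleftrightarrow> ?R")
  proof
    assume L: ?L
    show ?R
    proof (intro conjI allI impI)
      show "y = x" using L [rule_format, of 0] step.hyps xs(1) ys(1) n by simp
      fix p assume "p < m" "p \<noteq> i - 1 \<and> p \<noteq> i"
      then show "ys' ! p = xs' ! p"
        using L [rule_format, of "Suc p"] step.hyps xs(1) ys(1) n by auto
    qed
  next
    assume R: ?R
    show ?L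
    proof (intro allI impI)
      fix p assume p: "p < n" "p \<noteq> i \<and> p \<noteq> Suc i"
      show "ys ! p = xs ! p"
      proof (cases p)
        case 0 then show ?thesis using R xs(1) ys(1) by simp
      next
        case (Suc p') then show ?thesis using R xs(1) ys(1) p n step.hyps by auto
      qed
    qed
  qed
  moreover have "ys' ! (i - 1) = ys ! i" "xs' ! (i - 1) = xs ! i"
    using step.hyps xs(1) ys(1) by (simp_all add: nth_Cons')
  moreover have "ent (genop R i) ys' xs' = gen_op R m i ys' xs'"
    using step n xs ys by simp
  ultimately show ?case
    using xs ys step.hyps
    by (auto simp: genop_Suc sh_def ent_emp lid_def gen_op_def)
qed

section \<open>Representations of braid words and their intertwiners\<close>

definition rhop :: "(nat \<times> nat \<Rightarrow> nat \<times> nat \<Rightarrow> 'a::field) \<Rightarrow> (nat \<times> nat \<Rightarrow> nat \<times> nat \<Rightarrow> 'a)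
    \<Rightarrow> int list \<Rightarrow> 'a op" where
  "rhop R M w = prod_list (map (\<lambda>g. genop (if g > 0 then R else M) (nat \<bar>g\<bar>)) w)"

lemma rhop_simps [simp]:
  "rhop R M [] = 1"
  "rhop R M (g # w) = genop (if g > 0 then R else M) (nat \<bar>g\<bar>) * rhop R M w"
  by (simp_all add: rhop_def)

lemma braid_word_simps [simp]:
  "braid_word n []"
  "braid_word n (g # w) \<longleftrightarrow> 1 \<le> nat \<bar>g\<bar> \<and> nat \<bar>g\<bar> < n \<and> braid_word n w"
  by (auto simp: braid_word_def)

lemma rho_eq_ent_rhop:
  assumes "braid_word n w" "Rinv4 R = M" "ys \<in> tbasis n" "xs \<in> tbasis n"
  shows "rho R n w ys xs = ent (rhop R M w) ys xs"
  using assms(1,3)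
proof (induction w arbitrary: ys)
  case Nil
  then show ?case using assms(4) by (simp add: rho_def tid_def ent_one tbasis_def)
next
  case (Cons g w)
  have n: "length xs = n" using assms(4) by (simp add: tbasis_def)
  have "rho R n (g # w) ys xs =
      (\<Sum>zs\<in>tbasis n. gen_op (if g > 0 then R else Rinv4 R) n (nat \<bar>g\<bar>) ys zs * rho R n w zs xs)"
    by (simp add: rho_def tmul_def)
  also have "\<dots> = (\<Sum>zs\<in>tbasis n. ent (genop (if g > 0 then R else M) (nat \<bar>g\<bar>)) ys zs * ent (rhop R M w) zs xs)"
    using Cons assms by (intro sum.cong refl) (auto simp: ent_genop)
  finally show ?case by (simp add: ent_times n)
qed

text \<open>Serves both for commutation, with \<open>R' = R\<close>, and for intertwining two
  different representations.\<close>

lemma rhop_commute: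
  assumes "\<And>i. i \<ge> 1 \<Longrightarrow> C * genop R i = genop R' i * C"
    and "\<And>i. i \<ge> 1 \<Longrightarrow> C * genop M i = genop M' i * C"
    and "braid_word n w"
  shows "C * rhop R M w = rhop R' M' w * C"
  using assms(3)
proof (induction w)
  case (Cons g w)
  let ?s = "\<lambda>R M. genop (if g > 0 then R else M) (nat \<bar>g\<bar>)"
  have g: "C * ?s R M = ?s R' M' * C" using assms(1,2) [of "nat \<bar>g\<bar>"] Cons.prems by (cases "g > 0") simp_all
  have "C * rhop R M (g # w) = (C * ?s R M) * rhop R M w" by (simp add: mult.assoc)
  also have "\<dots> = ?s R' M' * (C * rhop R M w)" by (simp only: g mult.assoc)
  also have "\<dots> = rhop R' M' (g # w) * C" using Cons by (simp add: mult.assoc)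
  finally show ?case .
qed simp

text \<open>Multiplying the relation for the generator by inverses on both sides turns it into the
  relation for the inverse generator.\<close>

lemma genop_commute_inverse:
  assumes "C * genop R i = genop R' i * C" "peq (pmul R M) pid" "peq (pmul M' R') pid" "i \<ge> 1"
  shows "C * genop M i = genop M' i * C"
proof -
  have "C * genop M i = genop M' i * genop R' i * C * genop M i"
    using genop_inverse [OF assms(3,4)] by simp
  also have "\<dots> = genop M' i * (C * genop R i) * genop M i"
    using assms(1) by (simp add: mult.assoc)
  also have "\<dots> = genop M' i * C"
    using genop_inverse [OF assms(2,4)] by (simp add: mult.assoc)
  finally show ?thesis .
qed

section \<open>Grouplike diagonal operators and weights\<close>

definition ldiag :: "(nat \<Rightarrow> 'a::field) \<Rightarrow> nat \<Rightarrow> nat \<Rightarrow> 'a" where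
  "ldiag c y x = (if y = x then c x else 0)"

lift_definition dg :: "(nat \<Rightarrow> 'a::field) \<Rightarrow> 'a op" is
  "\<lambda>c ys xs. if ys = xs \<and> xs \<in> tbasis (length xs) then prod_list (map c xs) else 0"
  by (auto split: if_splits)

lemma ent_dg: "ent (dg c) ys xs = (if ys = xs \<and> xs \<in> tbasis (length xs) then prod_list (map c xs) else 0)"
  by transfer simp

lemma dg_rec: "dg c = emp + ten (ldiag c) (dg c)"
proof (rule op_eqI)
  fix ys xs
  show "ent (dg c) ys xs = ent (emp + ten (ldiag c) (dg c)) ys xs"
    by (cases ys; cases xs) (auto simp: ent_dg ent_emp tbasis_0 Cons_in_tbasis ldiag_def)
qed

lemma dg_one: "dg (\<lambda>_. 1) = 1"
  by (rule op_eqI) (simp add: ent_dg ent_one map_replicate_const prod_list_replicate)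

lemma dg_times_dg: "dg c * dg d = dg (\<lambda>x. c x * d x)"
proof (rule op_eqI)
  fix ys xs
  have *: "prod_list (map (\<lambda>x. c x * d x) zs) = prod_list (map c zs) * prod_list (map d zs)" for zs :: "nat list"
    by (induction zs) simp_all
  have "ent (dg c * dg d) ys xs = (\<Sum>zs\<in>tbasis (length xs). if zs = xs then ent (dg c) ys xs * ent (dg d) xs xs else 0)"
    unfolding ent_times by (intro sum.cong refl) (auto simp: ent_dg)
  then show "ent (dg c * dg d) ys xs = ent (dg (\<lambda>x. c x * d x)) ys xs"
    by (auto simp: ent_dg *)
qed

text \<open>Weights: \<open>u\<^sub>1, u\<^sub>2, u\<^sub>3, u\<^sub>4\<close> have the bidegrees \<open>(0,0), (1,0), (0,1), (1,1)\<close>.\<close>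

definition wtp :: "nat \<Rightarrow> nat" where
  "wtp x = (if x = 2 \<or> x = 4 then 1 else 0)"

definition wtq :: "nat \<Rightarrow> nat" where
  "wtq x = (if x = 3 \<or> x = 4 then 1 else 0)"

definition wt_preserving :: "(nat \<times> nat \<Rightarrow> nat \<times> nat \<Rightarrow> 'a::field) \<Rightarrow> bool" where
  "wt_preserving R \<longleftrightarrow> (\<forall>k\<in>letters. \<forall>l\<in>letters. \<forall>i\<in>letters. \<forall>j\<in>letters. R (k, l) (i, j) \<noteq> 0 \<longrightarrow>
     wtp k + wtp l = wtp i + wtp j \<and> wtq k + wtq l = wtq i + wtq j)"

text \<open>The only two different unordered pairs of letters with equal total bidegree are 1, 4 and
  2, 3. The condition therefore makes \<open>c k * c l\<close> a function of the total
  bidegree.\<close>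

definition character :: "(nat \<Rightarrow> 'a::field) \<Rightarrow> bool" where
  "character c \<longleftrightarrow> c 1 * c 4 = c 2 * c 3"

lemma character_wt:
  assumes "character c" "k \<in> letters" "l \<in> letters" "i \<in> letters" "j \<in> letters"
    "wtp k + wtp l = wtp i + wtp j" "wtq k + wtq l = wtq i + wtq j"
  shows "c k * c l = c i * c j"
  using assms by (auto simp: character_def letter_cases wtp_def wtq_def mult.commute)

text \<open>A weight-preserving matrix connects only pairs of letters on which \<open>c\<close>
  \<otimes> \<open>c\<close> takes the same value.\<close>

lemma pmul_diag_commute:
  assumes "wt_preserving R" "character c"
  shows "peq (pmul (ptens (ldiag c) (ldiag c)) R) (pmul R (ptens (ldiag c) (ldiag c)))"
  unfolding peq_def
proof (intro ballI)
  fix kl ij assume "kl \<in> pairs4" "ij \<in> pairs4"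
  then obtain k l i j where kl: "kl = (k, l)" "k \<in> letters" "l \<in> letters"
    and ij: "ij = (i, j)" "i \<in> letters" "j \<in> letters"
    by (auto simp: pairs4_letters)
  have fin: "finite letters" by (simp add: letters_def)
  have *: "ldiag c k a * ldiag c l b * R (a, b) (i, j) =
      (if l = b then if k = a then c k * c l * R (k, l) (i, j) else 0 else 0)"
    "R (k, l) (a, b) * (ldiag c a i * ldiag c b j) =
      (if b = j then if a = i then R (k, l) (i, j) * (c i * c j) else 0 else 0)" for a b
    by (auto simp: ldiag_def)
  have "c k * c l * R kl ij = R kl ij * (c i * c j)"
    using assms character_wt [of c k l i j] kl ij by (auto simp: wt_preserving_def)
  then show "pmul (ptens (ldiag c) (ldiag c)) R kl ij = pmul R (ptens (ldiag c) (ldiag c)) kl ij"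
    using kl ij by (simp add: pmul_def sum_pairs4 ptens_def * fin)
qed

lemma dg_rec2: "dg c = emp + ten (ldiag c) emp + ten2 (ptens (ldiag c) (ldiag c)) (dg c)"
proof -
  have "dg c = emp + ten (ldiag c) (emp + ten (ldiag c) (dg c))"
    using dg_rec by metis
  then show ?thesis by (simp add: ten_linear ten_ten add.assoc)
qed

lemma dg_commute_genop:
  assumes "wt_preserving R" "character c" "i \<ge> 1"
  shows "dg c * genop R i = genop R i * dg c"
  using assms(3)
proof (induction i rule: dec_induct)
  case base
  show ?case
    by (subst (1 2) dg_rec2)
      (simp add: genop_1 distrib_left distrib_right pairop_times_ten2 ten2_cong [OF pmul_diag_commute [OF assms(1,2)]])
next
  case (step i)
  then show ?case
    by (subst (1 2) dg_rec)
      (simp add: genop_Suc distrib_left distrib_right sh_def ten_times_ten)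
qed

section \<open>The twist\<close>

definition agree :: "nat \<Rightarrow> 'a::field op \<Rightarrow> 'a op \<Rightarrow> bool" where
  "agree n A B \<longleftrightarrow> (\<forall>ys xs. length xs < n \<longrightarrow> ent A ys xs = ent B ys xs)"

lemma agree_refl [simp]: "agree n A A"
  by (simp add: agree_def)

lemma agree_eqI: "(\<And>n. agree n A B) \<Longrightarrow> A = B"
  by (rule op_eqI) (auto simp: agree_def)

lemma agree_plus: "agree n A A' \<Longrightarrow> agree n B B' \<Longrightarrow> agree n (A + B) (A' + B')"
  by (simp add: agree_def)

lemma agree_times: "agree n A A' \<Longrightarrow> agree n B B' \<Longrightarrow> agree n (A * B) (A' * B')"
  unfolding agree_def ent_times by (intro allI impI sum.cong refl) (auto simp: tbasis_def)

lemma agree_ten: "agree n A B \<Longrightarrow> agree (Suc n) (ten X A) (ten X B)"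
  unfolding agree_def
proof (intro allI impI)
  fix ys xs :: "nat list"
  assume "\<forall>ys xs. length xs < n \<longrightarrow> ent A ys xs = ent B ys xs" "length xs < Suc n"
  then show "ent (ten X A) ys xs = ent (ten X B) ys xs"
    by (cases ys; cases xs) auto
qed

lemma agree_sh: "agree n A B \<Longrightarrow> agree (Suc n) (sh A) (sh B)"
  by (simp add: sh_def agree_plus agree_ten)

text \<open>Recursions whose value on words of length \<open>n\<close> only needs the value on shorter words have a unique
  solution.\<close>

definition contractive :: "('a::field op \<Rightarrow> 'a op) \<Rightarrow> bool" where
  "contractive \<Phi> \<longleftrightarrow> (\<forall>n A B. agree n A B \<longrightarrow> agree (Suc n) (\<Phi> A) (\<Phi> B))"

lemma contractive_unique:
  assumes "contractive \<Phi>" "A = \<Phi> A" "B = \<Phi> B"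
  shows "A = B"
proof (rule agree_eqI)
  fix n show "agree n A B"
  proof (induction n)
    case 0 then show ?case by (simp add: agree_def)
  next
    case (Suc n)
    then show ?case using assms by (metis contractive_def)
  qed
qed

text \<open>Words of length \<open>n\<close> are shorter than \<open>n + 1\<close>, so their entries
  are taken from member \<open>n + 1\<close> of the sequence, where the iterates of a contractive
  map have become stable.\<close>

lift_definition diag_limit :: "(nat \<Rightarrow> 'a::field op) \<Rightarrow> 'a op" is
  "\<lambda>A ys xs. A (Suc (length xs)) ys xs"
  by blast

definition fixop :: "('a::field op \<Rightarrow> 'a op) \<Rightarrow> 'a op" where
  "fixop \<Phi> = diag_limit (\<lambda>n. (\<Phi> ^^ n) 0)"

text \<open>By contractivity all iterates from the \<open>n\<close>-th on agree on words shorter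
  than \<open>n\<close>. The iteration thus stabilises entry by entry, and its limit is a fixed
  point.\<close>

lemma fixop_eq:
  assumes "contractive \<Phi>"
  shows "fixop \<Phi> = \<Phi> (fixop \<Phi>)"
proof -
  have iter: "agree n ((\<Phi> ^^ m) 0) ((\<Phi> ^^ n) 0)" if "m \<ge> n" for m n
    using that
  proof (induction n arbitrary: m)
    case 0 then show ?case by (simp add: agree_def)
  next
    case (Suc n)
    then obtain m' where "m = Suc m'" "m' \<ge> n" by (metis Suc_le_D Suc_le_mono)
    then show ?case using Suc assms by (simp add: contractive_def)
  qed
  have lim: "agree n (fixop \<Phi>) ((\<Phi> ^^ n) 0)" for n
    unfolding agree_def
  proof (intro allI impI)
    fix ys xs :: "nat list"
    assume "length xs < n"
    then have "agree (Suc (length xs)) ((\<Phi> ^^ n) 0) ((\<Phi> ^^ Suc (length xs)) 0)"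
      by (intro iter) simp
    then show "ent (fixop \<Phi>) ys xs = ent ((\<Phi> ^^ n) 0) ys xs"
      by (simp add: agree_def fixop_def diag_limit.rep_eq)
  qed
  show ?thesis
  proof (rule agree_eqI)
    fix n
    have "agree (Suc n) (\<Phi> (fixop \<Phi>)) ((\<Phi> ^^ Suc n) 0)"
      using lim assms by (simp add: contractive_def)
    then have "agree (Suc n) (fixop \<Phi>) (\<Phi> (fixop \<Phi>))"
      using lim [of "Suc n"] by (simp add: agree_def)
    then show "agree n (fixop \<Phi>) (\<Phi> (fixop \<Phi>))" by (simp add: agree_def)
  qed
qed

lemma contractive_affine_ten: "contractive (\<lambda>A. C + ten K A)"
  by (simp add: contractive_def agree_plus agree_ten)

lemma contractive_ten: "contractive (ten K)"
  by (simp add: contractive_def agree_ten)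

text \<open>Uniqueness for homogeneous recursions; this is how commutators, anticommutators and
  squares of coproducts are shown to vanish.\<close>

lemma ten_fixpoint_zero: "A = ten K A \<Longrightarrow> A = 0"
  by (rule contractive_unique [OF contractive_ten, of _ K]) (assumption, simp add: ten_linear)

lemma contractive_sh: "contractive (\<lambda>A. C * sh A * D)"
  by (simp add: contractive_def agree_times agree_sh)

text \<open>The iterated coproducts of \<open>X\<close> for \<open>\<Delta>X = X \<otimes> c + k \<otimes> X\<close>, with \<open>c\<close> and \<open>k\<close> diagonal and grouplike.\<close>

definition delta :: "(nat \<Rightarrow> nat \<Rightarrow> 'a::field) \<Rightarrow> (nat \<Rightarrow> 'a) \<Rightarrow> (nat \<Rightarrow> 'a) \<Rightarrow> 'a op" where
  "delta X k c = fixop (\<lambda>A. ten X (dg c) + ten (ldiag k) A)"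

lemma delta_rec: "delta X k c = ten X (dg c) + ten (ldiag k) (delta X k c)"
  unfolding delta_def by (rule fixop_eq [OF contractive_affine_ten])

text \<open>Unrolls the coproduct over two strands: its value on one strand, its value on the first
  two strands followed by \<open>c\<close>, and \<open>k\<close> \<otimes> \<open>k\<close> followed
  by the coproduct on the rest.\<close>

lemma delta_rec2:
  "delta X k c = ten X emp + ten2 (\<lambda>kl ij. ptens X (ldiag c) kl ij + ptens (ldiag k) X kl ij) (dg c)
     + ten2 (ptens (ldiag k) (ldiag k)) (delta X k c)"
proof -
  have "delta X k c = ten X (dg c) + ten (ldiag k) (delta X k c)"
    by (rule delta_rec)
  also have "\<dots> = ten X (emp + ten (ldiag c) (dg c))
      + ten (ldiag k) (ten X (dg c) + ten (ldiag k) (delta X k c))"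
    by (rule arg_cong2 [of _ _ _ _ "(+)"], subst dg_rec, rule refl, subst delta_rec, rule refl)
  also have "\<dots> = ten X emp + ten2 (\<lambda>kl ij. ptens X (ldiag c) kl ij + ptens (ldiag k) X kl ij) (dg c)
     + ten2 (ptens (ldiag k) (ldiag k)) (delta X k c)"
    by (simp add: ten_linear ten_ten add.assoc ten2_add_left [symmetric])
  finally show ?thesis .
qed

text \<open>For the first generator the unrolled form reduces the claim to the two-strand identity
  \<open>X\<close> and to weight preservation for \<open>k\<close> \<otimes> \<open>k\<close>. A
  later generator leaves the first strand idle, so commutation with \<open>dg c\<close> and
  induction on the tail suffice.\<close>

lemma delta_commute_genop:
  fixes X :: "nat \<Rightarrow> nat \<Rightarrow> 'a::field"
  assumes "wt_preserving R" "character k" "character c" "i \<ge> 1"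
    and X: "peq (pmul (\<lambda>kl ij. ptens X (ldiag c) kl ij + ptens (ldiag k) X kl ij) R)
      (pmul R (\<lambda>kl ij. ptens X (ldiag c) kl ij + ptens (ldiag k) X kl ij))"
  shows "delta X k c * genop R i = genop R i * delta X k c"
  using assms(4)
proof (induction i rule: dec_induct)
  case base
  show ?case
    by (subst (1 2) delta_rec2)
      (simp add: genop_1 distrib_left distrib_right pairop_times_ten2 ten2_cong [OF X]
        ten2_cong [OF pmul_diag_commute [OF assms(1,2)]])
next
  case (step i)
  then show ?case
    using dg_commute_genop [OF assms(1,3)]
    by (subst (1 2) delta_rec)
      (simp add: genop_Suc distrib_left distrib_right)
qed

lemma lmul_ldiag [simp]:
  "y \<in> letters \<Longrightarrow> x \<in> letters \<Longrightarrow> lmul (ldiag c) X y x = c y * X y x"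
  "y \<in> letters \<Longrightarrow> x \<in> letters \<Longrightarrow> lmul X (ldiag c) y x = X y x * c x"
  by (auto simp: lmul_def ldiag_def sum_letters letter_cases)

lemma ten_lmul_ldiag_commute: "ten (lmul (ldiag c) (ldiag d)) A = ten (lmul (ldiag d) (ldiag c)) A"
  by (rule ten_cong) (simp add: ldiag_def)

lemma dg_commute: "dg c * dg d = dg d * dg c"
  by (simp add: dg_times_dg mult.commute)

lemma dg_times_ten: "dg c * ten X A = ten (lmul (ldiag c) X) (dg c * A)"
  by (subst dg_rec) (simp add: distrib_right ten_times_ten)

lemma ten_times_dg: "ten X A * dg c = ten (lmul X (ldiag c)) (A * dg c)"
  by (subst dg_rec) (simp add: distrib_left ten_times_ten)

text \<open>The assumption removes the inhomogeneous term from the recursion of the anticommutator,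
  which is therefore zero.\<close>

lemma dg_delta_anticommute:
  assumes "\<And>y x. y \<in> letters \<Longrightarrow> x \<in> letters \<Longrightarrow> h y * X y x = - (X y x * h x)"
  shows "dg h * delta X k c = - (delta X k c * dg h)"
proof -
  let ?U = "dg h * delta X k c + delta X k c * dg h"
  have "?U = (ten (lmul (ldiag h) X) (dg h * dg c) + ten (lmul X (ldiag h)) (dg h * dg c))
      + ten (lmul (ldiag h) (ldiag k)) ?U"
    by (subst (1 2) delta_rec)
      (simp add: distrib_left distrib_right dg_times_ten ten_times_dg ten_linear ten_lmul_ldiag_commute [of k h]
        dg_commute [of c h])
  also have "ten (lmul (ldiag h) X) (dg h * dg c) + ten (lmul X (ldiag h)) (dg h * dg c) = ten (\<lambda>_ _. 0) 0"
    unfolding ten_add_left by (rule op_eq_blkI) (use assms in auto)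
  also have "ten (\<lambda>_ _. 0) 0 + ten (lmul (ldiag h) (ldiag k)) ?U = ten (lmul (ldiag h) (ldiag k)) ?U"
    by (simp only: ten_linear(3) add_0_left)
  finally have "?U = ten (lmul (ldiag h) (ldiag k)) ?U" .
  then have "?U = 0"
    by (rule ten_fixpoint_zero)
  then show ?thesis by (simp add: eq_neg_iff_add_eq_0)
qed

lemma dg_delta_commute:
  assumes "\<And>y x. y \<in> letters \<Longrightarrow> x \<in> letters \<Longrightarrow> h y * X y x = X y x * h x"
  shows "dg h * delta X k c = delta X k c * dg h"
proof -
  let ?U = "dg h * delta X k c - delta X k c * dg h"
  have X: "ten (lmul (ldiag h) X) A = ten (lmul X (ldiag h)) A" for A
    by (rule ten_cong) (use assms in auto)
  have "?U = ten (lmul (ldiag h) (ldiag k)) ?U"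
    by (subst (1 2) delta_rec)
      (simp add: distrib_left distrib_right dg_times_ten ten_times_dg ten_linear ten_lmul_ldiag_commute [of k h]
        dg_commute [of c h] X)
  then have "?U = 0"
    by (rule ten_fixpoint_zero)
  then show ?thesis by simp
qed

text \<open>Cyclicity of the trace and the anticommutation with \<open>h\<close> cancel the off-diagonal block.\<close>

lemma partial_trace_eq:
  assumes comm: "delta X k (\<lambda>_. 1) * A = A * delta X k (\<lambda>_. 1)"
    and h: "\<And>y x. y \<in> letters \<Longrightarrow> x \<in> letters \<Longrightarrow> h y * X y x = - (X y x * h x)"
    and xy: "x \<in> letters" "y \<in> letters" "X x y = 1" "k y = - k x"
    and X0: "\<And>z. z \<in> letters \<Longrightarrow> z \<noteq> y \<Longrightarrow> X x z = 0" "\<And>z. z \<in> letters \<Longrightarrow> z \<noteq> x \<Longrightarrow> X z y = 0"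
  shows "tr n (dg h * blk x x A) = tr n (dg h * blk y y A)"
proof -
  let ?d = "delta X k (\<lambda>_. 1)" and ?B = "blk x y A"
  have d: "blk u v ?d = smul (X u v) 1 + smul (ldiag k u v) ?d" if "u \<in> letters" "v \<in> letters" for u v
    by (subst delta_rec) (simp add: that dg_one)
  have fin: "finite letters" by (simp add: letters_def)
  \<comment> \<open>The block between the two letters joined by \<open>X\<close> is the one in which
    the commutation relation compares the two diagonal blocks of \<open>A\<close>.\<close>
  have "blk x y (?d * A) = (\<Sum>z\<in>letters. (if z = y then blk y y A else 0) + (if z = x then smul (k x) (?d * ?B) else 0))"
    unfolding blk_times using xy X0
    by (intro sum.cong refl) (auto simp: d distrib_right ldiag_def)
  then have L: "blk x y (?d * A) = blk y y A + smul (k x) (?d * ?B)"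
    using xy fin by (simp add: sum.distrib)
  have "blk x y (A * ?d) = (\<Sum>z\<in>letters. (if z = x then blk x x A else 0) + (if z = y then smul (k y) (?B * ?d) else 0))"
    unfolding blk_times using xy X0
    by (intro sum.cong refl) (auto simp: d distrib_left ldiag_def)
  then have R: "blk x y (A * ?d) = blk x x A + smul (k y) (?B * ?d)"
    using xy fin by (simp add: sum.distrib)
  have "dg h * ?d = - (?d * dg h)"
    by (rule dg_delta_anticommute) (rule h)
  then have "tr n (dg h * (?d * ?B)) = - tr n (dg h * (?B * ?d))"
    using tr_times_commute [of n ?d "dg h * ?B"]
    by (simp add: mult.assoc [symmetric])
  moreover have "tr n (dg h * (blk y y A + smul (k x) (?d * ?B)))
      = tr n (dg h * (blk x x A + smul (k y) (?B * ?d)))"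
    using L R comm by simp
  ultimately show ?thesis
    using xy(4) by (simp add: distrib_left)
qed

section \<open>The odd operators and their coproducts\<close>

definition fmat :: "nat \<Rightarrow> nat \<Rightarrow> 'a::field" where
  "fmat y x = (if (y, x) = (2, 1) \<or> (y, x) = (4, 3) then 1 else 0)"

definition emat :: "'a::field \<Rightarrow> 'a \<Rightarrow> nat \<Rightarrow> nat \<Rightarrow> 'a" where
  "emat s t y x = (if (y, x) = (1, 2) then 1 - s else if (y, x) = (3, 4) then 1 - inverse t else 0)"

definition kchar :: "nat \<Rightarrow> 'a::field" where
  "kchar x = (if x = 2 \<or> x = 4 then -1 else 1)"

definition gchar :: "'a::field \<Rightarrow> 'a \<Rightarrow> nat \<Rightarrow> 'a" where
  "gchar s t x = (if x = 1 \<or> x = 2 then s else inverse t)"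

abbreviation eps :: "'a::field \<Rightarrow> 'a \<Rightarrow> 'a op" where
  "eps s t \<equiv> delta (emat s t) kchar (\<lambda>_. 1)"

abbreviation phi :: "'a::field \<Rightarrow> 'a \<Rightarrow> 'a op" where
  "phi s t \<equiv> delta fmat kchar (gchar s t)"

lemma eps_rec: "eps s t = ten (emat s t) 1 + ten (ldiag kchar) (eps s t)"
  by (subst delta_rec) (simp add: dg_one)

lemma phi_rec: "phi s t = ten fmat (dg (gchar s t)) + ten (ldiag kchar) (phi s t)"
  by (rule delta_rec)

text \<open>The letter matrix squares to zero and anticommutes with \<open>kchar\<close>, whose
  square is 1. Only the term carrying the square on the remaining strands survives, which is a
  homogeneous recursion.\<close>

lemma eps_square: "eps s t * eps s t = 0"
proof -
  have z: "ten (lmul (emat s t) (emat s t)) A = 0"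
    "ten (lmul (emat s t) (ldiag kchar)) A + ten (lmul (ldiag kchar) (emat s t)) A = 0"
    "ten (lmul (ldiag kchar) (ldiag kchar)) A = ten lid A" for A
    unfolding ten_add_left
    by (rule op_eq_blkI; auto simp: lmul_def sum_letters emat_def kchar_def ldiag_def lid_def letter_cases)+
  have "eps s t * eps s t = (ten (lmul (emat s t) (ldiag kchar)) (eps s t) + ten (lmul (ldiag kchar) (emat s t)) (eps s t))
      + (ten (lmul (emat s t) (emat s t)) 1 + ten (lmul (ldiag kchar) (ldiag kchar)) (eps s t * eps s t))"
    by (subst (1 2) eps_rec) (simp add: distrib_left distrib_right ten_times_ten)
  also have "\<dots> = ten lid (eps s t * eps s t)"
    by (simp only: z add_0_left)
  finally have "eps s t * eps s t = ten lid (eps s t * eps s t)" .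
  then show ?thesis
    by (rule ten_fixpoint_zero)
qed

text \<open>On one letter the anticommutator is \<open>1 - g\<close>, and \<open>kchar\<close>
  anticommutes with both letter matrices, so the cross terms cancel. Both sides solve the same
  recursion: (\<open>1 - g\<close>) \<otimes> \<open>G\<close> plus the shifted unknown.\<close>

lemma eps_phi: "eps s t * phi s t + phi s t * eps s t = 1 - dg (gchar s t)"
proof (rule contractive_unique [OF contractive_affine_ten])
  let ?G = "dg (gchar s t)"
  have z: "ten (lmul (emat s t) fmat) A + ten (lmul fmat (emat s t)) A = ten (\<lambda>y x. lid y x - ldiag (gchar s t) y x) A"
    "ten (lmul (emat s t) (ldiag kchar)) A + ten (lmul (ldiag kchar) (emat s t)) A = 0"
    "ten (lmul fmat (ldiag kchar)) A + ten (lmul (ldiag kchar) fmat) A = 0"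
    "ten (lmul (ldiag kchar) (ldiag kchar)) A = ten lid A" for A
    unfolding ten_add_left
    by (rule op_eq_blkI; auto simp: lmul_def sum_letters emat_def fmat_def gchar_def kchar_def ldiag_def lid_def letter_cases)+
  have G: "?G * eps s t = eps s t * ?G"
    by (rule dg_delta_commute) (auto simp: gchar_def emat_def)
  have "eps s t * phi s t + phi s t * eps s t =
      (ten (lmul (emat s t) fmat) ?G + ten (lmul fmat (emat s t)) ?G)
      + (ten (lmul (emat s t) (ldiag kchar)) (phi s t) + ten (lmul (ldiag kchar) (emat s t)) (phi s t))
      + (ten (lmul fmat (ldiag kchar)) (eps s t * ?G) + ten (lmul (ldiag kchar) fmat) (eps s t * ?G))
      + ten (lmul (ldiag kchar) (ldiag kchar)) (eps s t * phi s t + phi s t * eps s t)"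
    by (subst (1 2) eps_rec, subst (1 2) phi_rec)
      (simp add: distrib_left distrib_right ten_times_ten ten_linear G)
  also have "\<dots> = ten (\<lambda>y x. lid y x - ldiag (gchar s t) y x) ?G
      + ten lid (eps s t * phi s t + phi s t * eps s t)"
    by (simp only: z add_0_right)
  finally show "eps s t * phi s t + phi s t * eps s t = ten (\<lambda>y x. lid y x - ldiag (gchar s t) y x) ?G
      + ten lid (eps s t * phi s t + phi s t * eps s t)" .
  have "1 - ?G = (emp + ten lid 1) - (emp + ten (ldiag (gchar s t)) ?G)"
    by (rule arg_cong2 [of _ _ _ _ "(-)", OF one_eq_emp_ten dg_rec])
  moreover have "ten lid 1 - ten (ldiag (gchar s t)) ?G =
      ten (\<lambda>y x. lid y x - ldiag (gchar s t) y x) ?G + ten lid (1 - ?G)"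
    by (rule op_eqI, rename_tac ys xs, case_tac ys; case_tac xs) (simp_all add: algebra_simps)
  ultimately show "1 - ?G = ten (\<lambda>y x. lid y x - ldiag (gchar s t) y x) ?G + ten lid (1 - ?G)"
    by simp
qed

section \<open>The intertwiner \<open>J\<close> and its inverse\<close>

definition Jstep :: "'a::field \<Rightarrow> 'a \<Rightarrow> 'a op" where
  "Jstep s t = 1 + ten fmat (eps s t)"

definition Jstep_inv :: "'a::field \<Rightarrow> 'a \<Rightarrow> 'a op" where
  "Jstep_inv s t = 1 - ten fmat (eps s t)"

lemma Jstep_Jstep_inv: "Jstep s t * Jstep_inv s t = 1" "Jstep_inv s t * Jstep s t = 1"
proof -
  have "ten fmat (eps s t) * ten fmat (eps s t) = 0"
    by (simp add: ten_times_ten eps_square ten_linear)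
  then show "Jstep s t * Jstep_inv s t = 1" "Jstep_inv s t * Jstep s t = 1"
    by (simp_all add: Jstep_def Jstep_inv_def algebra_simps)
qed

text \<open>The factor \<open>1\<close>, here and in \<open>Jop_inv\<close>, brings the recursion to
  the shape of \<open>contractive_sh\<close>.\<close>

definition Jop :: "'a::field \<Rightarrow> 'a \<Rightarrow> 'a op" where
  "Jop s t = fixop (\<lambda>A. 1 * sh A * Jstep s t)"

definition Jop_inv :: "'a::field \<Rightarrow> 'a \<Rightarrow> 'a op" where
  "Jop_inv s t = fixop (\<lambda>A. Jstep_inv s t * sh A * 1)"

lemma Jop_rec: "Jop s t = sh (Jop s t) * Jstep s t"
  unfolding Jop_def using fixop_eq [OF contractive_sh, of 1 "Jstep s t"] by simp

lemma Jop_inv_rec: "Jop_inv s t = Jstep_inv s t * sh (Jop_inv s t)"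
  unfolding Jop_inv_def using fixop_eq [OF contractive_sh, of "Jstep_inv s t" 1] by simp

lemma Jop_Jop_inv: "Jop s t * Jop_inv s t = 1"
proof (rule contractive_unique [OF contractive_sh [of 1 1]])
  have "Jop s t * Jop_inv s t = sh (Jop s t) * (Jstep s t * Jstep_inv s t) * sh (Jop_inv s t)"
    by (subst Jop_rec, subst Jop_inv_rec) (simp add: mult.assoc)
  then show "Jop s t * Jop_inv s t = 1 * sh (Jop s t * Jop_inv s t) * 1"
    by (simp add: Jstep_Jstep_inv sh_times_sh)
qed simp

text \<open>In this order the product satisfies the recursion conjugated by \<open>Jstep\<close>, of
  which 1 is again a solution.\<close>

lemma Jop_inv_Jop: "Jop_inv s t * Jop s t = 1"
proof (rule contractive_unique [OF contractive_sh [of "Jstep_inv s t" "Jstep s t"]])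
  have "Jop_inv s t * Jop s t = Jstep_inv s t * (sh (Jop_inv s t) * sh (Jop s t)) * Jstep s t"
    by (subst Jop_rec, subst Jop_inv_rec) (simp add: mult.assoc)
  then show "Jop_inv s t * Jop s t = Jstep_inv s t * sh (Jop_inv s t * Jop s t) * Jstep s t"
    by (simp add: sh_times_sh)
qed (simp add: Jstep_Jstep_inv)

lemma hV_anticommute:
  "y \<in> letters \<Longrightarrow> x \<in> letters \<Longrightarrow> hV y * emat s t y x = - (emat s t y x * hV x)"
  "y \<in> letters \<Longrightarrow> x \<in> letters \<Longrightarrow> hV y * fmat y x = - (fmat y x * hV x)"
  by (auto simp: hV_def emat_def fmat_def)

text \<open>Both legs of \<open>f\<close> \<otimes> \<open>eps\<close> anticommute with the weight,
  so the two signs cancel and the weight passes through every factor of \<open>J\<close>. Formally,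
  both products solve one contractive recursion.\<close>

lemma hV_Jop: "dg hV * Jop s t = Jop s t * dg hV"
proof (rule contractive_unique)
  let ?\<Theta> = "\<lambda>A. (emp + ten (ldiag hV) A) * Jstep s t"
  show "contractive ?\<Theta>"
    by (simp add: contractive_def agree_times agree_plus agree_ten)
  have "dg hV * Jop s t = dg hV * sh (Jop s t) * Jstep s t"
    by (subst Jop_rec) (simp add: mult.assoc)
  also have "dg hV * sh (Jop s t) = emp + ten (ldiag hV) (dg hV * Jop s t)"
    by (subst dg_rec) (simp add: sh_def distrib_left distrib_right ten_times_ten)
  finally show "dg hV * Jop s t = ?\<Theta> (dg hV * Jop s t)" .
  have "dg hV * ten fmat (eps s t) = ten (lmul (ldiag hV) fmat) (dg hV * eps s t)"
    by (simp add: dg_times_ten)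
  also have "\<dots> = ten (lmul fmat (ldiag hV)) (eps s t * dg hV)"
  proof -
    have "ten (lmul (ldiag hV) fmat) (- (eps s t * dg hV)) = ten (lmul fmat (ldiag hV)) (eps s t * dg hV)"
    proof (rule op_eq_blkI)
      fix y x :: nat assume "y \<in> letters" "x \<in> letters"
      then show "blk y x (ten (lmul (ldiag hV) fmat) (- (eps s t * dg hV))) =
        blk y x (ten (lmul fmat (ldiag hV)) (eps s t * dg hV))"
        by (intro op_eqI) (simp add: hV_anticommute)
    qed simp
    then show ?thesis by (simp add: dg_delta_anticommute hV_anticommute)
  qed
  also have "\<dots> = ten fmat (eps s t) * dg hV"
    by (simp add: ten_times_dg)
  finally have "Jstep s t * dg hV = dg hV * Jstep s t"
    by (simp add: Jstep_def distrib_left distrib_right)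
  then have "Jop s t * dg hV = sh (Jop s t) * dg hV * Jstep s t"
    by (subst Jop_rec) (simp add: mult.assoc)
  also have "sh (Jop s t) * dg hV = emp + ten (ldiag hV) (Jop s t * dg hV)"
    by (subst dg_rec) (simp add: sh_def distrib_left distrib_right ten_times_ten)
  finally show "Jop s t * dg hV = ?\<Theta> (Jop s t * dg hV)" .
qed

definition Fp :: "'a::field \<Rightarrow> 'a \<Rightarrow> nat \<times> nat \<Rightarrow> nat \<times> nat \<Rightarrow> 'a" where
  "Fp s t kl ij = pid kl ij + ptens fmat (emat s t) kl ij"

text \<open>The two-strand coefficient of \<open>eps\<close>, taken on the third and later strands,
  in \<open>sh (Jstep s t) * Jstep s t\<close>.\<close>

definition Bp :: "'a::field \<Rightarrow> 'a \<Rightarrow> nat \<times> nat \<Rightarrow> nat \<times> nat \<Rightarrow> 'a" where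
  "Bp s t kl ij = ptens fmat (ldiag kchar) kl ij + pmul (ptens lid fmat) (Fp s t) kl ij"

lemma Jstep_rec2: "Jstep s t = emp + ten lid emp + ten2 (Fp s t) 1 + ten2 (ptens fmat (ldiag kchar)) (eps s t)"
proof -
  have "ten fmat (eps s t) = ten2 (ptens fmat (emat s t)) 1 + ten2 (ptens fmat (ldiag kchar)) (eps s t)"
    by (subst eps_rec) (simp add: ten_linear ten_ten)
  moreover have "ten2 (Fp s t) 1 = ten2 pid 1 + ten2 (ptens fmat (emat s t)) 1"
    by (simp add: ten2_add_left) (rule ten2_cong, simp add: Fp_def peq_def)
  ultimately show ?thesis
    using pairop_pid by (simp add: Jstep_def pairop_def [of pid, symmetric] add.assoc) (simp add: pairop_def add.assoc)
qed

lemma sh_Jstep: "sh (Jstep s t) = emp + ten lid emp + ten2 pid 1 + ten2 (ptens lid fmat) (eps s t)"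
proof -
  have "sh (Jstep s t) = sh 1 + ten lid (ten fmat (eps s t))"
    unfolding Jstep_def by (simp only: sh_def ten_linear) (simp add: add.assoc)
  then show ?thesis
    using pairop_pid by (simp add: ten_ten) (simp add: pairop_def add.assoc)
qed

text \<open>The term quadratic in \<open>eps\<close> vanishes by \<open>eps_square\<close>, so the
  part of \<open>J\<close> that involves the first two strands is affine in
  \<open>eps\<close>.\<close>

lemma sh_Jstep_times_Jstep:
  "sh (Jstep s t) * Jstep s t = emp + ten lid emp + ten2 (Fp s t) 1 + ten2 (Bp s t) (eps s t)"
proof -
  have p: "ten2 (pmul pid Q) A = ten2 Q A" for Q :: "nat \<times> nat \<Rightarrow> nat \<times> nat \<Rightarrow> 'a" and A
  proof (rule ten2_cong)
    have "finite pairs4" by (simp add: pairs4_def)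
    then show "peq (pmul pid Q) Q"
      by (simp add: peq_def pmul_def pid_def if_distrib [of "\<lambda>u. u * _"] cong: if_cong)
  qed
  have "ten2 (Bp s t) A = ten2 (ptens fmat (ldiag kchar)) A + ten2 (pmul (ptens lid fmat) (Fp s t)) A" for A
    by (simp add: ten2_add_left) (rule ten2_cong, simp add: Bp_def peq_def)
  then show ?thesis
    unfolding sh_Jstep
    by (subst Jstep_rec2) (simp add: distrib_left distrib_right ten2_times_ten2 ten_times_ten eps_square ten2_linear p add.assoc)
qed

text \<open>For the first generator, \<open>J\<close> is an operator on the strands from the third
  on, which commutes with that generator, times the affine expression in \<open>eps\<close>; the two
  matrix identities \<open>F\<close> and \<open>B\<close> treat its two coefficients. For later
  generators \<open>Jstep\<close> commutes with the shifted generator, and induction applies to the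
  shifted \<open>J\<close>.\<close>

lemma Jop_genop:
  fixes R :: "nat \<times> nat \<Rightarrow> nat \<times> nat \<Rightarrow> 'a::field"
  assumes eps: "\<And>i. i \<ge> 1 \<Longrightarrow> eps s t * genop R i = genop R i * eps s t"
    and F: "peq (pmul (Fp s t) R) (pmul R' (Fp s t))"
    and B: "peq (pmul (Bp s t) R) (pmul R' (Bp s t))"
    and i: "i \<ge> 1"
  shows "Jop s t * genop R i = genop R' i * Jop s t"
  using i
proof (induction i rule: dec_induct)
  case base
  let ?T = "sh (Jstep s t) * Jstep s t" and ?J = "sh (sh (Jop s t))"
  have "Jop s t = sh (sh (Jop s t) * Jstep s t) * Jstep s t"
    by (subst Jop_rec, subst Jop_rec) (rule refl)
  also have "\<dots> = ?J * ?T"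
    by (simp only: sh_times_sh [symmetric] mult.assoc)
  finally have J: "Jop s t = ?J * ?T" .
  have T: "?T * pairop R = pairop R' * ?T"
    unfolding sh_Jstep_times_Jstep
    by (simp add: distrib_left distrib_right pairop_times_ten2 ten2_cong [OF F] ten2_cong [OF B])
  have "?J = emp + ten lid emp + ten2 pid (Jop s t)"
    by (simp add: sh_def ten_linear ten_ten ptens_lid_lid add.assoc)
  moreover have "ten2 (pmul pid Q) A = ten2 Q A \<and> ten2 (pmul Q pid) A = ten2 Q A"
    for Q :: "nat \<times> nat \<Rightarrow> nat \<times> nat \<Rightarrow> 'a" and A
  proof -
    have "finite pairs4" by (simp add: pairs4_def)
    then show ?thesis
      by (intro conjI ten2_cong)
        (auto simp: peq_def pmul_def pid_def if_distrib [of "\<lambda>u. u * _"] if_distrib [of "\<lambda>u. _ * u"] cong: if_cong)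
  qed
  ultimately have "?J * pairop R' = pairop R' * ?J"
    by (simp add: distrib_left distrib_right pairop_times_ten2)
  then have "?J * ?T * pairop R = pairop R' * (?J * ?T)"
    by (metis T mult.assoc)
  then show ?case
    unfolding One_nat_def genop_1 by (simp only: J [symmetric])
next
  case (step i)
  have Jstep: "Jstep s t * sh (genop R i) = sh (genop R i) * Jstep s t"
    using eps [of i] step.hyps by (simp add: Jstep_def distrib_left distrib_right)
  have "Jop s t * sh (genop R i) = sh (Jop s t) * (Jstep s t * sh (genop R i))"
    by (subst Jop_rec) (simp add: mult.assoc)
  also have "\<dots> = sh (Jop s t * genop R i) * Jstep s t"
    by (simp add: Jstep sh_times_sh mult.assoc [symmetric])
  also have "\<dots> = sh (genop R' i) * (sh (Jop s t) * Jstep s t)"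
    by (simp add: step.IH sh_times_sh [symmetric] mult.assoc)
  also have "sh (Jop s t) * Jstep s t = Jop s t"
    by (rule Jop_rec [symmetric])
  finally show ?case by (simp only: genop_Suc [OF step.hyps(1)])
qed

section \<open>How the twist changes the weights\<close>

lemma letter_pair_cases:
  assumes "x \<in> letters"
  obtains u v where "x = u \<or> x = v" "(u, v) = (1, 2) \<or> (u, v) = (3, 4)"
  using assms by (auto simp: letter_cases)

lemma twisted_partial_trace:
  fixes s t :: "'a::field"
  assumes comm: "phi s t * A = A * phi s t" and st: "s \<noteq> 0" "t \<noteq> 0" and x: "x \<in> letters"
  shows "tr n (dg hV * blk x x (Jop s t * A * Jop_inv s t)) = tr n (dg (\<lambda>x. hV x * inverse (gchar s t x)) * blk x x A)"
proof -
  let ?e = "eps s t" and ?f = "phi s t" and ?G = "dg (gchar s t)" and ?H = "dg hV"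
  let ?I = "dg (\<lambda>x. inverse (gchar s t x))" and ?J = "Jop s t" and ?C = "Jstep s t * A * Jstep_inv s t"
  have GI: "?G * ?I = 1" "?I * ?G = 1"
    using st by (simp_all add: dg_times_dg gchar_def dg_one cong: if_cong)
  have HI: "dg (\<lambda>x. hV x * inverse (gchar s t x)) = ?H * ?I" "?I * ?H = ?H * ?I"
    by (simp_all add: dg_times_dg mult.commute)
  have Ie: "?I * ?e = ?e * ?I" and If: "?I * ?f = ?f * ?I"
    by (rule dg_delta_commute; auto simp: gchar_def emat_def fmat_def)+
  have He: "?H * ?e = - (?e * ?H)" and Hf: "?H * ?f = - (?f * ?H)"
    by (rule dg_delta_anticommute; simp add: hV_anticommute)+
  have fH: "?f * ?H = - (?H * ?f)" using Hf by simp
  have ef: "?e * ?f + ?f * ?e = 1 - ?G" by (rule eps_phi)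
  \<comment> \<open>Only the last factor \<open>Jstep\<close> of \<open>J\<close> mixes first
    letters. The shifted factor acts inside each block, commutes with \<open>?H\<close>, and so
    disappears from the trace by cyclicity.\<close>
  have "?J * A * Jop_inv s t = sh ?J * ?C * sh (Jop_inv s t)"
    by (subst Jop_rec, subst Jop_inv_rec) (simp add: mult.assoc)
  then have "blk x x (?J * A * Jop_inv s t) = ?J * blk x x ?C * Jop_inv s t"
    using x by (auto simp: blk_times sum_letters blk_sh letter_cases)
  then have "tr n (?H * blk x x (?J * A * Jop_inv s t)) = tr n (?H * ?J * blk x x ?C * Jop_inv s t)"
    by (simp add: mult.assoc)
  also have "\<dots> = tr n (?J * (?H * blk x x ?C * Jop_inv s t))"
    by (simp add: hV_Jop mult.assoc)
  also have "\<dots> = tr n (?H * blk x x ?C * (Jop_inv s t * ?J))"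
    by (subst tr_times_commute) (simp add: mult.assoc)
  finally have red: "tr n (?H * blk x x (?J * A * Jop_inv s t)) = tr n (?H * blk x x ?C)"
    by (simp add: Jop_inv_Jop)
  obtain u v where uv: "x = u \<or> x = v" "(u, v) = (1, 2) \<or> (u, v) = (3, 4)"
    using letter_pair_cases x by blast
  let ?B = "blk u v A"
  have f: "blk y z ?f = smul (fmat y z) ?G + smul (ldiag kchar y z) ?f" if "y \<in> letters" "z \<in> letters" for y z
    by (subst delta_rec) (simp add: that)
  have Jstep: "blk y z (Jstep s t) = (if y = z then 1 else 0) + smul (fmat y z) ?e"
    "blk y z (Jstep_inv s t) = (if y = z then 1 else 0) - smul (fmat y z) ?e" if "y \<in> letters" "z \<in> letters" for y z
    by (simp_all add: Jstep_def Jstep_inv_def that blk_one)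
  note blocks = blk_times sum_letters f Jstep fmat_def ldiag_def kchar_def
  show ?thesis
    using uv(1)
  proof
    assume xu: "x = u"
    let ?D = "blk u u A"
    have C: "blk u u ?C = ?D - ?B * ?e"
      using uv(2) by (auto simp: blocks algebra_simps)
    \<comment> \<open>Row \<open>u\<close> of the letter matrix \<open>fmat\<close> is zero. Hence
      the diagonal block of \<open>comm\<close> at \<open>u\<close> expresses \<open>?B\<close>
      through \<open>?D\<close>, up to the invertible factor \<open>?G\<close>.\<close>
    have "blk u u (?f * A) = ?f * ?D" "blk u u (A * ?f) = ?B * ?G + ?D * ?f"
      using uv(2) by (auto simp: blocks algebra_simps)
    then have "?B * ?G = ?f * ?D - ?D * ?f" using comm by (simp add: algebra_simps)
    then have B: "?B = (?f * ?D - ?D * ?f) * ?I"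
      using GI by (metis mult.assoc mult.right_neutral)
    \<comment> \<open>Passing \<open>?H\<close> costs a sign, and cyclicity carries
      \<open>?f\<close> to the right of \<open>?e\<close>. The two halves of the commutator then
      combine to the anticommutator of \<open>?e\<close> and \<open>?f\<close>.\<close>
    have "tr n (?H * (?f * ?D * ?I * ?e)) = - tr n (?f * (?H * ?D * ?I * ?e))"
      using Hf by (simp add: mult.assoc [symmetric])
    also have "tr n (?f * (?H * ?D * ?I * ?e)) = tr n (?H * ?D * ?I * (?e * ?f))"
      by (subst tr_times_commute) (simp add: mult.assoc)
    finally have 1: "tr n (?H * (?f * ?D * ?I * ?e)) = - tr n (?H * ?D * ?I * (?e * ?f))" .
    have "?D * ?f * ?I * ?e = ?D * ?I * (?f * ?e)"
      by (simp add: mult.assoc If [symmetric])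
    then have "tr n (?H * (?B * ?e)) = - tr n (?H * ?D * ?I * (?e * ?f)) - tr n (?H * ?D * ?I * (?f * ?e))"
      using 1 by (simp add: B left_diff_distrib right_diff_distrib mult.assoc)
    also have "\<dots> = - tr n (?H * ?D * ?I * (?e * ?f + ?f * ?e))"
      by (simp add: distrib_left)
    also have "\<dots> = tr n (?H * ?D) - tr n (?H * ?D * ?I)"
      unfolding ef using GI by (simp add: right_diff_distrib mult.assoc)
    finally have "tr n (?H * blk u u ?C) = tr n (?H * ?D * ?I)"
      by (simp add: C right_diff_distrib)
    also have "\<dots> = tr n (?H * ?I * ?D)"
      by (subst tr_times_commute) (simp add: mult.assoc [symmetric] HI)
    finally show ?thesis using red xu HI by simp
  next
    assume xv: "x = v"
    let ?D = "blk v v A"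
    have C: "blk v v ?C = ?D + ?e * ?B"
      using uv(2) by (auto simp: blocks algebra_simps)
    \<comment> \<open>For the second letter of the pair it is column \<open>v\<close> of
      \<open>fmat\<close> that is zero: \<open>?G\<close> now stands to the left of
      \<open>?B\<close>, and the signs come from \<open>kchar v = -1\<close>.\<close>
    have "blk v v (?f * A) = ?G * ?B - ?f * ?D" "blk v v (A * ?f) = - (?D * ?f)"
      using uv(2) by (auto simp: blocks algebra_simps)
    then have "?G * ?B = ?f * ?D - ?D * ?f" using comm by (simp add: algebra_simps)
    then have B: "?B = ?I * (?f * ?D - ?D * ?f)"
      using GI by (metis mult.assoc mult.left_neutral)
    have "tr n (?H * ?e * ?I * ?D * ?f) = tr n (?f * ?H * (?e * ?I * ?D))"
      by (subst tr_times_commute) (simp add: mult.assoc)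
    also have "\<dots> = - tr n (?H * (?f * ?e) * ?I * ?D)"
      using fH by (simp add: mult.assoc [symmetric])
    finally have 1: "tr n (?H * ?e * ?I * ?D * ?f) = - tr n (?H * (?f * ?e) * ?I * ?D)" .
    have "?e * ?I * ?f = ?e * ?f * ?I" by (simp add: mult.assoc If)
    then have "tr n (?H * (?e * ?B)) = tr n (?H * (?e * ?f) * ?I * ?D) - tr n (?H * ?e * ?I * ?D * ?f)"
      by (simp add: B right_diff_distrib mult.assoc [symmetric])
    also have "\<dots> = tr n (?H * (?e * ?f + ?f * ?e) * ?I * ?D)"
      by (simp add: 1 distrib_left distrib_right)
    also have "\<dots> = tr n (?H * ?I * ?D) - tr n (?H * ?D)"
      unfolding ef using GI by (simp add: right_diff_distrib left_diff_distrib mult.assoc)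
    finally have "tr n (?H * blk v v ?C) = tr n (?H * ?I * ?D)"
      by (simp add: C distrib_left)
    then show ?thesis using red xv HI by simp
  qed
qed

section \<open>The matrices\<close>

definition RV_inv_img :: "'a::field \<Rightarrow> 'a \<Rightarrow> nat \<times> nat \<Rightarrow> ((nat \<times> nat) \<times> 'a) list" where
  "RV_inv_img s t ij =
     (if ij = (1,1) then [((1,1), -1)]
     else if ij = (1,2) then [((1,2), inverse s - 1), ((2,1), -1)]
     else if ij = (1,3) then [((1,3), inverse t - 1), ((3,1), -1)]
     else if ij = (1,4) then [((1,4), inverse s + inverse t - 2), ((2,3), inverse t - 1), ((3,2), t - 1), ((4,1), -1)]
     else if ij = (2,1) then [((1,2), - inverse s)]
     else if ij = (2,2) then [((2,2), inverse s)]
     else if ij = (2,3) then [((1,4), 1 - inverse s), ((3,2), - t)]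
     else if ij = (2,4) then [((2,4), inverse s - 1), ((4,2), t)]
     else if ij = (3,1) then [((1,3), - inverse t)]
     else if ij = (3,2) then [((1,4), (inverse s - 1) * inverse t), ((2,3), - inverse t)]
     else if ij = (3,3) then [((3,3), inverse t)]
     else if ij = (3,4) then [((3,4), inverse t - 1), ((4,3), inverse t)]
     else if ij = (4,1) then [((1,4), - (inverse s * inverse t))]
     else if ij = (4,2) then [((2,4), inverse s * inverse t)]
     else if ij = (4,3) then [((3,4), 1)]
     else if ij = (4,4) then [((4,4), -1)]
     else [])"

text \<open>The twisted matrix \<open>F\<^sup>-\<^sup>1 R\<^sub>V F\<close>.\<close>

definition RT_img :: "'a::field \<Rightarrow> 'a \<Rightarrow> nat \<times> nat \<Rightarrow> ((nat \<times> nat) \<times> 'a) list" where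
  "RT_img s t ij =
     (if ij = (1,1) then [((1,1), -1)]
     else if ij = (1,2) then [((1,2), s - 1), ((2,1), - s)]
     else if ij = (1,3) then [((3,1), - t)]
     else if ij = (1,4) then [((3,2), 1 - t), ((4,1), - (s * t))]
     else if ij = (2,1) then [((1,2), -1)]
     else if ij = (2,2) then [((2,2), s)]
     else if ij = (2,3) then [((3,2), - t)]
     else if ij = (2,4) then [((4,2), s * t)]
     else if ij = (3,1) then [((1,3), -1), ((3,1), t - 1)]
     else if ij = (3,2) then [((1,4), s - 1), ((2,3), - inverse t), ((3,2), (s - 1) * (1 - t)), ((4,1), (1 - s) * (s * t))]
     else if ij = (3,3) then [((3,3), t)]
     else if ij = (3,4) then [((3,4), t - 1), ((4,3), 1)]
     else if ij = (4,1) then [((1,4), -1), ((3,2), t - 1), ((4,1), s * t - 1)]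
     else if ij = (4,2) then [((2,4), inverse t), ((4,2), s - 1)]
     else if ij = (4,3) then [((3,4), t)]
     else if ij = (4,4) then [((4,4), -1)]
     else [])"

definition RT_inv_img :: "'a::field \<Rightarrow> 'a \<Rightarrow> nat \<times> nat \<Rightarrow> ((nat \<times> nat) \<times> 'a) list" where
  "RT_inv_img s t ij =
     (if ij = (1,1) then [((1,1), -1)]
     else if ij = (1,2) then [((2,1), -1)]
     else if ij = (1,3) then [((1,3), inverse t - 1), ((3,1), -1)]
     else if ij = (1,4) then [((1,4), inverse s * inverse t - 1), ((2,3), (inverse t - 1) * (inverse s * inverse t)), ((4,1), -1)]
     else if ij = (2,1) then [((1,2), - inverse s), ((2,1), inverse s - 1)]
     else if ij = (2,2) then [((2,2), inverse s)]
     else if ij = (2,3) then [((1,4), 1 - inverse s), ((2,3), (1 - inverse s) * (inverse t - 1)), ((3,2), - t), ((4,1), (1 - s) * t)]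
     else if ij = (2,4) then [((2,4), inverse s - 1), ((4,2), t)]
     else if ij = (3,1) then [((1,3), - inverse t)]
     else if ij = (3,2) then [((2,3), - inverse t)]
     else if ij = (3,3) then [((3,3), inverse t)]
     else if ij = (3,4) then [((4,3), inverse t)]
     else if ij = (4,1) then [((1,4), - (inverse s * inverse t)), ((2,3), (1 - inverse t) * (inverse s * inverse t))]
     else if ij = (4,2) then [((2,4), inverse s * inverse t)]
     else if ij = (4,3) then [((3,4), 1), ((4,3), inverse t - 1)]
     else if ij = (4,4) then [((4,4), -1)]
     else [])"

definition RLG_inv_img :: "'a::field \<Rightarrow> 'a \<Rightarrow> 'a \<Rightarrow> nat \<times> nat \<Rightarrow> ((nat \<times> nat) \<times> 'a) list" where
  "RLG_inv_img a b y ij =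
     (if ij = (1,1) then [((1,1), inverse (a^2))]
     else if ij = (1,2) then [((1,2), inverse (a^2) - 1), ((2,1), inverse a)]
     else if ij = (1,3) then [((1,3), inverse (a^2) - 1), ((3,1), inverse a)]
     else if ij = (1,4) then [((1,4), y^2 * inverse (a^2 * b^2)), ((2,3), y * inverse (a * b)), ((3,2), - (y * inverse (a^2 * b^2))), ((4,1), 1)]
     else if ij = (2,1) then [((1,2), inverse a)]
     else if ij = (2,2) then [((2,2), -1)]
     else if ij = (2,3) then [((1,4), y * inverse (a * b)), ((3,2), - inverse (a * b))]
     else if ij = (2,4) then [((2,4), inverse (b^2) - 1), ((4,2), inverse b)]
     else if ij = (3,1) then [((1,3), inverse a)]
     else if ij = (3,2) then [((1,4), - (y * inverse (a^2 * b^2))), ((2,3), - inverse (a * b)), ((3,2), inverse (a^2 * b^2) - 1)]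
     else if ij = (3,3) then [((3,3), -1)]
     else if ij = (3,4) then [((3,4), inverse (b^2) - 1), ((4,3), inverse b)]
     else if ij = (4,1) then [((1,4), 1)]
     else if ij = (4,2) then [((2,4), inverse b)]
     else if ij = (4,3) then [((3,4), inverse b)]
     else if ij = (4,4) then [((4,4), inverse (b^2))]
     else [])"


section \<open>Symbolic evaluation of sparse matrices\<close>

definition comp_img :: "(nat \<times> nat \<Rightarrow> ((nat \<times> nat) \<times> 'a::field) list)
    \<Rightarrow> (nat \<times> nat \<Rightarrow> ((nat \<times> nat) \<times> 'a) list) \<Rightarrow> nat \<times> nat \<Rightarrow> ((nat \<times> nat) \<times> 'a) list" where
  "comp_img f g ij = concat (map (\<lambda>(ab, c). map (\<lambda>(kl, d). (kl, d * c)) (f ab)) (g ij))"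

definition tens_img :: "(nat \<Rightarrow> (nat \<times> 'a::field) list) \<Rightarrow> (nat \<Rightarrow> (nat \<times> 'a) list)
    \<Rightarrow> nat \<times> nat \<Rightarrow> ((nat \<times> nat) \<times> 'a) list" where
  "tens_img f g ij = concat (map (\<lambda>(k, c). map (\<lambda>(l, d). ((k, l), c * d)) (g (snd ij))) (f (fst ij)))"

definition lcoeff :: "(nat \<Rightarrow> (nat \<times> 'a::field) list) \<Rightarrow> nat \<Rightarrow> nat \<Rightarrow> 'a" where
  "lcoeff f y x = sum_list (map snd (filter (\<lambda>p. fst p = y) (f x)))"

definition in_pairs4 :: "(nat \<times> nat \<Rightarrow> ((nat \<times> nat) \<times> 'a) list) \<Rightarrow> bool" where
  "in_pairs4 f \<longleftrightarrow> (\<forall>ij\<in>pairs4. \<forall>p\<in>set (f ij). fst p \<in> pairs4)"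

lemma sum_list_filter_eq:
  "sum_list (map snd (filter (\<lambda>p. fst p = k) xs)) = (\<Sum>p\<leftarrow>xs. if fst p = k then snd p else 0)"
  for xs :: "('b \<times> 'a::field) list"
  by (induction xs) auto

lemma coeff_of_append: "coeff_of (\<lambda>ij. f ij @ g ij) kl ij = coeff_of f kl ij + coeff_of g kl ij"
  by (simp add: coeff_of_def)

text \<open>Composing lists of images gives the matrix product as long as no intermediate pair
  leaves \<open>pairs4\<close>, the range of summation in \<open>pmul\<close>. Lists keep the
  products sparse enough for evaluation by simplification.\<close>

lemma coeff_of_comp_img:
  assumes "\<forall>p\<in>set (g ij). fst p \<in> pairs4"
  shows "coeff_of (comp_img f g) kl ij = pmul (coeff_of f) (coeff_of g) kl ij"
proof -
  have fin: "finite pairs4" by (simp add: pairs4_def)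
  have sc: "(\<Sum>p\<leftarrow>map (\<lambda>(kl, d). (kl, d * c)) ys. if fst p = kl then snd p else 0)
      = (\<Sum>p\<leftarrow>ys. if fst p = kl then snd p else 0) * c" for c :: 'a and ys
    by (induction ys) (auto simp: distrib_right)
  have "(\<Sum>p\<leftarrow>concat (map (\<lambda>(ab, c). map (\<lambda>(kl, d). (kl, d * c)) (f ab)) xs). if fst p = kl then snd p else 0)
      = (\<Sum>ab\<in>pairs4. (\<Sum>p\<leftarrow>f ab. if fst p = kl then snd p else 0) * (\<Sum>p\<leftarrow>xs. if fst p = ab then snd p else 0))"
    if "\<forall>p\<in>set xs. fst p \<in> pairs4" for xs
    using that
  proof (induction xs)
    case (Cons q xs)
    obtain ab c where q: "q = (ab, c)" by (cases q)
    have ab: "ab \<in> pairs4" using Cons.prems q by simp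
    have "(\<Sum>ab'\<in>pairs4. (\<Sum>p\<leftarrow>f ab'. if fst p = kl then snd p else 0) * (if ab = ab' then c else 0))
        = (\<Sum>p\<leftarrow>f ab. if fst p = kl then snd p else 0) * c"
      using fin ab by (simp add: if_distrib [of "\<lambda>u. _ * u"] cong: if_cong)
    moreover have "(\<Sum>p\<leftarrow>q # xs. if fst p = ab' then snd p else 0) =
        (if ab = ab' then c else 0) + (\<Sum>p\<leftarrow>xs. if fst p = ab' then snd p else 0)" for ab'
      by (simp add: q)
    ultimately show ?case
      using Cons by (simp add: q sc distrib_left sum.distrib del: map_map)
  qed simp
  from this [OF assms] show ?thesis
    unfolding coeff_of_def pmul_def sum_list_filter_eq comp_img_def .
qed

lemma coeff_of_tens_img: "coeff_of (tens_img f g) kl ij = ptens (lcoeff f) (lcoeff g) kl ij"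
proof -
  obtain k l where kl: "kl = (k, l)" by (cases kl)
  have inner: "(\<Sum>p\<leftarrow>map (\<lambda>(l, d). ((k', l), c * d)) ys. if fst p = kl then snd p else 0)
      = (if k' = k then c * (\<Sum>p\<leftarrow>ys. if fst p = l then snd p else 0) else 0)" for c :: 'a and ys k'
    by (induction ys) (auto simp: kl distrib_left)
  have "(\<Sum>p\<leftarrow>concat (map (\<lambda>(k, c). map (\<lambda>(l, d). ((k, l), c * d)) ys) xs). if fst p = kl then snd p else 0)
      = (\<Sum>p\<leftarrow>xs. if fst p = k then snd p else 0) * (\<Sum>p\<leftarrow>ys. if fst p = l then snd p else 0)" for xs ys :: "(nat \<times> 'a) list"
    by (induction xs) (auto simp: inner distrib_right simp del: map_map)
  then show ?thesis
    unfolding coeff_of_def lcoeff_def ptens_def sum_list_filter_eq tens_img_def by (simp add: kl)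
qed

lemma pmul_coeff_of_eqI:
  assumes "in_pairs4 g" "in_pairs4 g'"
    and "\<forall>ij\<in>pairs4. \<forall>kl\<in>pairs4. coeff_of (comp_img f g) kl ij = coeff_of (comp_img f' g') kl ij"
  shows "peq (pmul (coeff_of f) (coeff_of g)) (pmul (coeff_of f') (coeff_of g'))"
  using assms by (simp add: peq_def in_pairs4_def coeff_of_comp_img [symmetric])

lemma ball_pairs4:
  "(\<forall>ij\<in>pairs4. P ij) \<longleftrightarrow>
    P (1,1) \<and> P (1,2) \<and> P (1,3) \<and> P (1,4) \<and> P (2,1) \<and> P (2,2) \<and> P (2,3) \<and> P (2,4) \<and>
    P (3,1) \<and> P (3,2) \<and> P (3,3) \<and> P (3,4) \<and> P (4,1) \<and> P (4,2) \<and> P (4,3) \<and> P (4,4)"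
  by (auto simp: pairs4_letters letter_cases)

definition id_img :: "nat \<times> nat \<Rightarrow> ((nat \<times> nat) \<times> 'a::field) list" where
  "id_img ij = [(ij, 1)]"

lemma in_pairs4_imgs:
  "in_pairs4 (RV_img s t)" "in_pairs4 (RV_inv_img s t)" "in_pairs4 (RT_img s t)"
  "in_pairs4 (RT_inv_img s t)" "in_pairs4 (RLG_img a b y)" "in_pairs4 (RLG_inv_img a b y)"
  unfolding in_pairs4_def RV_img_def RV_inv_img_def RT_img_def RT_inv_img_def RLG_img_def RLG_inv_img_def
  by (simp_all add: ball_pairs4 Let_def) (simp_all add: pairs4_letters)

definition diag_col :: "(nat \<Rightarrow> 'a::field) \<Rightarrow> nat \<Rightarrow> (nat \<times> 'a) list" where
  "diag_col c x = [(x, c x)]"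

definition fmat_col :: "nat \<Rightarrow> (nat \<times> 'a::field) list" where
  "fmat_col x = (if x = 1 then [(2, 1)] else if x = 3 then [(4, 1)] else [])"

definition emat_col :: "'a::field \<Rightarrow> 'a \<Rightarrow> nat \<Rightarrow> (nat \<times> 'a) list" where
  "emat_col s t x = (if x = 2 then [(1, 1 - s)] else if x = 4 then [(3, 1 - inverse t)] else [])"

text \<open>Sends the letters 3, 4 to 1, 2. While \<open>fmat\<close> acts inside the pairs 1, 2 and
  3, 4, this operator joins the two pairs; its coproduct with \<open>zchar\<close> also commutes
  with the \<open>V_1\<close> matrix.\<close>

definition zmat :: "nat \<Rightarrow> nat \<Rightarrow> 'a::field" where
  "zmat y x = (if (y, x) = (1, 3) \<or> (y, x) = (2, 4) then 1 else 0)"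

definition zchar :: "'a::field \<Rightarrow> nat \<Rightarrow> 'a" where
  "zchar t x = (if x = 1 \<or> x = 2 then t else - t)"

definition zmat_col :: "nat \<Rightarrow> (nat \<times> 'a::field) list" where
  "zmat_col x = (if x = 3 then [(1, 1)] else if x = 4 then [(2, 1)] else [])"

lemma lcoeff_cols:
  "lcoeff (diag_col c) = ldiag c" "lcoeff fmat_col = fmat" "lcoeff (emat_col s t) = emat s t" "lcoeff zmat_col = zmat"
  by (auto simp: lcoeff_def diag_col_def fmat_col_def emat_col_def zmat_col_def ldiag_def fmat_def emat_def zmat_def fun_eq_iff)

lemma coeff_of_id_img: "coeff_of id_img = pid"
  by (auto simp: coeff_of_def id_img_def pid_def fun_eq_iff)

definition delta_img :: "(nat \<Rightarrow> (nat \<times> 'a::field) list) \<Rightarrow> (nat \<Rightarrow> 'a) \<Rightarrow> (nat \<Rightarrow> 'a)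
    \<Rightarrow> nat \<times> nat \<Rightarrow> ((nat \<times> nat) \<times> 'a) list" where
  "delta_img X k c ij = tens_img X (diag_col c) ij @ tens_img (diag_col k) X ij"

lemma coeff_of_delta_img:
  "coeff_of (delta_img X k c) = (\<lambda>kl ij. ptens (lcoeff X) (ldiag c) kl ij + ptens (ldiag k) (lcoeff X) kl ij)"
proof (intro ext)
  fix kl ij
  have "coeff_of (delta_img X k c) kl ij = coeff_of (\<lambda>ij. tens_img X (diag_col c) ij @ tens_img (diag_col k) X ij) kl ij"
    by (simp add: coeff_of_def delta_img_def)
  then show "coeff_of (delta_img X k c) kl ij =
      ptens (lcoeff X) (ldiag c) kl ij + ptens (ldiag k) (lcoeff X) kl ij"
    by (simp add: coeff_of_append coeff_of_tens_img lcoeff_cols)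
qed

definition F_img :: "'a::field \<Rightarrow> 'a \<Rightarrow> nat \<times> nat \<Rightarrow> ((nat \<times> nat) \<times> 'a) list" where
  "F_img s t ij = id_img ij @ tens_img fmat_col (emat_col s t) ij"

definition B_img :: "'a::field \<Rightarrow> 'a \<Rightarrow> nat \<times> nat \<Rightarrow> ((nat \<times> nat) \<times> 'a) list" where
  "B_img s t ij = tens_img fmat_col (diag_col kchar) ij @ comp_img (tens_img (diag_col (\<lambda>_. 1)) fmat_col) (F_img s t) ij"

lemmas img_evals = coeff_of_def comp_img_def tens_img_def delta_img_def id_img_def diag_col_def fmat_col_def emat_col_def
  zmat_col_def F_img_def B_img_def kchar_def gchar_def zchar_def

lemma in_pairs4_aux:
  "in_pairs4 id_img" "in_pairs4 (F_img s t)" "in_pairs4 (B_img s t)"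
  "in_pairs4 (delta_img fmat_col k c)" "in_pairs4 (delta_img (emat_col s t) k c)" "in_pairs4 (delta_img zmat_col k c)"
  by (simp_all add: in_pairs4_def ball_pairs4 img_evals) (simp_all add: pairs4_letters)

lemma coeff_of_F_img: "coeff_of (F_img s t) = Fp s t"
proof (intro ext)
  fix kl ij
  have "coeff_of (F_img s t) kl ij = coeff_of (\<lambda>ij. id_img ij @ tens_img fmat_col (emat_col s t) ij) kl ij"
    by (simp add: coeff_of_def F_img_def)
  then show "coeff_of (F_img s t) kl ij = Fp s t kl ij"
    by (simp add: coeff_of_append coeff_of_tens_img lcoeff_cols coeff_of_id_img Fp_def)
qed

lemma coeff_of_B_img:
  fixes s t :: "'a::field"
  shows "peq (coeff_of (B_img s t)) (Bp s t)"
  unfolding peq_def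
proof (intro ballI)
  fix kl ij assume "ij \<in> pairs4"
  then have "\<forall>p\<in>set (F_img s t ij). fst p \<in> pairs4"
    using in_pairs4_aux(2) by (auto simp: in_pairs4_def)
  moreover have "coeff_of (B_img s t) kl ij = coeff_of (\<lambda>ij. tens_img fmat_col (diag_col kchar) ij
      @ comp_img (tens_img (diag_col (\<lambda>_. 1)) fmat_col) (F_img s t) ij) kl ij"
    by (simp add: coeff_of_def B_img_def)
  moreover have "ldiag (\<lambda>_. 1 :: 'a) = lid"
    by (simp add: fun_eq_iff ldiag_def lid_def)
  moreover have "coeff_of (tens_img (diag_col (\<lambda>_. 1 :: 'a)) fmat_col) = ptens (ldiag (\<lambda>_. 1)) fmat"
    by (simp add: fun_eq_iff coeff_of_tens_img lcoeff_cols)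
  ultimately show "coeff_of (B_img s t) kl ij = Bp s t kl ij"
    by (simp add: coeff_of_append coeff_of_tens_img coeff_of_comp_img lcoeff_cols coeff_of_F_img Bp_def)
qed

lemma pmul_coeff_of_pidI:
  assumes "in_pairs4 g" "\<forall>ij\<in>pairs4. \<forall>kl\<in>pairs4. coeff_of (comp_img f g) kl ij = coeff_of id_img kl ij"
  shows "peq (pmul (coeff_of f) (coeff_of g)) pid"
  using assms by (simp add: peq_def in_pairs4_def coeff_of_comp_img [symmetric] coeff_of_id_img)

section \<open>The finite matrix identities, checked entry by entry\<close>

context
  fixes s t :: "'a::field"
  assumes st: "s \<noteq> 0" "t \<noteq> 0"
begin

lemma RV_inverse:
  "peq (pmul (coeff_of (RV_img s t)) (coeff_of (RV_inv_img s t))) pid"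
  "peq (pmul (coeff_of (RV_inv_img s t)) (coeff_of (RV_img s t))) pid"
  by (rule pmul_coeff_of_pidI [OF in_pairs4_imgs(2)] pmul_coeff_of_pidI [OF in_pairs4_imgs(1)],
      unfold ball_pairs4, simp add: img_evals RV_img_def RV_inv_img_def, simp add: field_simps st)+

lemma RT_inverse:
  "peq (pmul (coeff_of (RT_img s t)) (coeff_of (RT_inv_img s t))) pid"
  "peq (pmul (coeff_of (RT_inv_img s t)) (coeff_of (RT_img s t))) pid"
  by (rule pmul_coeff_of_pidI [OF in_pairs4_imgs(4)] pmul_coeff_of_pidI [OF in_pairs4_imgs(3)],
      unfold ball_pairs4, simp add: img_evals RT_img_def RT_inv_img_def, simp add: field_simps st)+

lemma F_intertwines: "peq (pmul (Fp s t) (coeff_of (RT_img s t))) (pmul (coeff_of (RV_img s t)) (Fp s t))"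
  unfolding coeff_of_F_img [symmetric]
  by (rule pmul_coeff_of_eqI [OF in_pairs4_imgs(3) in_pairs4_aux(2)], unfold ball_pairs4)
    (simp add: img_evals RT_img_def RV_img_def, simp add: field_simps st)

lemma B_intertwines: "peq (pmul (Bp s t) (coeff_of (RT_img s t))) (pmul (coeff_of (RV_img s t)) (Bp s t))"
proof -
  have "peq (pmul (coeff_of (B_img s t)) (coeff_of (RT_img s t))) (pmul (coeff_of (RV_img s t)) (coeff_of (B_img s t)))"
    by (rule pmul_coeff_of_eqI [OF in_pairs4_imgs(3) in_pairs4_aux(3)], unfold ball_pairs4)
      (simp add: img_evals RT_img_def RV_img_def, simp add: field_simps st)
  then show ?thesis
    using coeff_of_B_img [of s t] unfolding peq_def pmul_def by simp
qed

lemma eps_commutes: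
  "peq (pmul (\<lambda>kl ij. ptens (emat s t) (ldiag (\<lambda>_. 1)) kl ij + ptens (ldiag kchar) (emat s t) kl ij) (coeff_of (RT_img s t)))
    (pmul (coeff_of (RT_img s t)) (\<lambda>kl ij. ptens (emat s t) (ldiag (\<lambda>_. 1)) kl ij + ptens (ldiag kchar) (emat s t) kl ij))"
  unfolding lcoeff_cols(3) [symmetric] coeff_of_delta_img [symmetric]
  by (rule pmul_coeff_of_eqI [OF in_pairs4_imgs(3) in_pairs4_aux(5)], unfold ball_pairs4)
    (simp add: img_evals RT_img_def, simp add: field_simps st)

lemma phi_commutes:
  "peq (pmul (\<lambda>kl ij. ptens fmat (ldiag (gchar s t)) kl ij + ptens (ldiag kchar) fmat kl ij) (coeff_of (RT_img s t)))
    (pmul (coeff_of (RT_img s t)) (\<lambda>kl ij. ptens fmat (ldiag (gchar s t)) kl ij + ptens (ldiag kchar) fmat kl ij))"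
  unfolding lcoeff_cols(2) [symmetric] coeff_of_delta_img [symmetric]
  by (rule pmul_coeff_of_eqI [OF in_pairs4_imgs(3) in_pairs4_aux(4)], unfold ball_pairs4)
    (simp add: img_evals RT_img_def, simp add: field_simps st)

lemma phi_commutes_RV:
  "peq (pmul (\<lambda>kl ij. ptens fmat (ldiag (\<lambda>_. 1)) kl ij + ptens (ldiag kchar) fmat kl ij) (coeff_of (RV_img s t)))
    (pmul (coeff_of (RV_img s t)) (\<lambda>kl ij. ptens fmat (ldiag (\<lambda>_. 1)) kl ij + ptens (ldiag kchar) fmat kl ij))"
  unfolding lcoeff_cols(2) [symmetric] coeff_of_delta_img [symmetric]
  by (rule pmul_coeff_of_eqI [OF in_pairs4_imgs(1) in_pairs4_aux(4)], unfold ball_pairs4)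
    (simp add: img_evals RV_img_def, simp add: field_simps st)

lemma zeta_commutes_RV:
  "peq (pmul (\<lambda>kl ij. ptens zmat (ldiag (\<lambda>_. 1)) kl ij + ptens (ldiag (zchar t)) zmat kl ij) (coeff_of (RV_img s t)))
    (pmul (coeff_of (RV_img s t)) (\<lambda>kl ij. ptens zmat (ldiag (\<lambda>_. 1)) kl ij + ptens (ldiag (zchar t)) zmat kl ij))"
  unfolding lcoeff_cols(4) [symmetric] coeff_of_delta_img [symmetric]
  by (rule pmul_coeff_of_eqI [OF in_pairs4_imgs(1) in_pairs4_aux(6)], unfold ball_pairs4)
    (simp add: img_evals RV_img_def, simp add: field_simps st)

end

lemma RLG_inverse:
  fixes a b y :: "'a::field"
  assumes "a \<noteq> 0" "b \<noteq> 0" and y: "y^2 = (a^2 - 1) * (1 - b^2)"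
  shows "peq (pmul (coeff_of (RLG_img a b y)) (coeff_of (RLG_inv_img a b y))) pid"
    "peq (pmul (coeff_of (RLG_inv_img a b y)) (coeff_of (RLG_img a b y))) pid"
proof -
  \<comment> \<open>With the inverses as variables subject to \<open>a * A = 1\<close> and
    \<open>b * B = 1\<close>, every entry becomes a polynomial identity modulo these relations and
    the one for \<open>y^2\<close>.\<close>
  define A B where AB: "A = inverse a" "B = inverse b"
  have A: "a * A = 1" and B: "b * B = 1" using assms by (simp_all add: AB)
  have inv: "inverse (a^2) = A^2" "inverse (b^2) = B^2" "inverse (a * b) = A * B"
    "inverse (a^2 * b^2) = A^2 * B^2" "inverse a = A" "inverse b = B"
    by (simp_all add: AB power_inverse)
  show "peq (pmul (coeff_of (RLG_img a b y)) (coeff_of (RLG_inv_img a b y))) pid"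
    apply (rule pmul_coeff_of_pidI [OF in_pairs4_imgs(6)])
    unfolding ball_pairs4 RLG_inv_img_def inv
    apply (simp add: img_evals RLG_img_def Let_def)
    apply (intro conjI; use A B y in algebra)
    done
  show "peq (pmul (coeff_of (RLG_inv_img a b y)) (coeff_of (RLG_img a b y))) pid"
    apply (rule pmul_coeff_of_pidI [OF in_pairs4_imgs(5)])
    unfolding ball_pairs4 RLG_inv_img_def inv
    apply (simp add: img_evals RLG_img_def Let_def)
    apply (intro conjI; use A B y in algebra)
    done
qed

lemma wt_preserving_imgs:
  "wt_preserving (coeff_of (RV_img s t))" "wt_preserving (coeff_of (RT_img s t))"
proof -
  have *: "wt_preserving R \<longleftrightarrow> (\<forall>ij\<in>pairs4. \<forall>kl\<in>pairs4. R kl ij \<noteq> 0 \<longrightarrow>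
      wtp (fst kl) + wtp (snd kl) = wtp (fst ij) + wtp (snd ij) \<and>
      wtq (fst kl) + wtq (snd kl) = wtq (fst ij) + wtq (snd ij))"
    for R :: "nat \<times> nat \<Rightarrow> nat \<times> nat \<Rightarrow> 'a"
    unfolding wt_preserving_def pairs4_letters by auto
  show "wt_preserving (coeff_of (RV_img s t))"
    unfolding * ball_pairs4 by (simp add: coeff_of_def RV_img_def wtp_def wtq_def)
  show "wt_preserving (coeff_of (RT_img s t))"
    unfolding * ball_pairs4 by (simp add: coeff_of_def RT_img_def wtp_def wtq_def)
qed

section \<open>Traces\<close>

text \<open>\<open>is_inverse4\<close> prescribes zeros outside \<open>pairs4\<close>, so an inverse
  is unique as a function. On \<open>pairs4\<close> uniqueness is the usual ring argument, with the
  matrix entries read off from two-letter words.\<close>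

lemma Rinv4_eqI:
  assumes M0: "\<And>kl ij. kl \<notin> pairs4 \<or> ij \<notin> pairs4 \<Longrightarrow> M kl ij = 0"
    and RM: "peq (pmul R M) pid" and MR: "peq (pmul M R) pid"
  shows "Rinv4 R = M"
  unfolding Rinv4_def
proof (rule the_equality)
  show "is_inverse4 R M"
    using assms by (auto simp: is_inverse4_def peq_def pmul_def pid_def)
next
  fix N assume N: "is_inverse4 R N"
  then have "peq (pmul N R) pid"
    by (simp add: is_inverse4_def peq_def pmul_def pid_def)
  then have "pairop N * pairop R = 1"
    by (rule pairop_inverse)
  then have "pairop N * (pairop R * pairop M) = pairop M"
    by (simp add: mult.assoc [symmetric])
  then have eq: "pairop N = pairop M"
    by (simp add: pairop_inverse [OF RM])
  show "N = M"
  proof (intro ext)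
    fix kl ij
    show "N kl ij = M kl ij"
    proof (cases "kl \<in> pairs4 \<and> ij \<in> pairs4")
      case True
      obtain k l i j where "kl = (k, l)" "ij = (i, j)" by (cases kl, cases ij)
      then show ?thesis
        using True arg_cong [OF eq, of "\<lambda>A. ent A [k, l] [i, j]"]
        by (auto simp: pairop_def ent_emp ent_one tbasis_0)
    next
      case False
      then show ?thesis using N M0 unfolding is_inverse4_def by metis
    qed
  qed
qed

lemma coeff_of_outside:
  assumes "in_pairs4 f" "\<And>ij. ij \<notin> pairs4 \<Longrightarrow> f ij = []" "kl \<notin> pairs4 \<or> ij \<notin> pairs4"
  shows "coeff_of f kl ij = 0"
proof (cases "ij \<in> pairs4")
  case True
  then have "filter (\<lambda>p. fst p = kl) (f ij) = []"
    using assms by (auto simp: in_pairs4_def filter_empty_conv)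
  then show ?thesis by (simp add: coeff_of_def)
qed (simp add: coeff_of_def assms(2))

lemma inv_img_outside:
  assumes "ij \<notin> pairs4"
  shows "RV_inv_img s t ij = []" "RLG_inv_img a b y ij = []"
proof -
  have "\<forall>p\<in>pairs4. ij \<noteq> p" using assms by blast
  then show "RV_inv_img s t ij = []" "RLG_inv_img a b y ij = []"
    unfolding ball_pairs4 by (simp_all add: RV_inv_img_def RLG_inv_img_def)
qed

lemma Rinv4_RV:
  "s \<noteq> 0 \<Longrightarrow> t \<noteq> 0 \<Longrightarrow> Rinv4 (coeff_of (RV_img s t)) = coeff_of (RV_inv_img s t)"
  by (rule Rinv4_eqI) (auto intro!: coeff_of_outside in_pairs4_imgs inv_img_outside RV_inverse)

lemma Rinv4_RLG:
  "a \<noteq> 0 \<Longrightarrow> b \<noteq> 0 \<Longrightarrow> y^2 = (a^2 - 1) * (1 - b^2) \<Longrightarrow>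
    Rinv4 (coeff_of (RLG_img a b y)) = coeff_of (RLG_inv_img a b y)"
  by (rule Rinv4_eqI) (auto intro!: coeff_of_outside in_pairs4_imgs inv_img_outside RLG_inverse)

section \<open>The trace formula and the partial traces\<close>

definition markov_trace :: "(nat \<Rightarrow> 'a::field) \<Rightarrow> nat \<Rightarrow> 'a op \<Rightarrow> 'a" where
  "markov_trace h n A = (\<Sum>xs\<in>tbasis n. prod_list (map h (tl xs)) * ent A xs xs)"

lemma ent_dg_times: "xs \<in> tbasis n \<Longrightarrow> ent (dg h * A) xs xs = prod_list (map h xs) * ent A xs xs"
proof -
  assume xs: "xs \<in> tbasis n"
  then have n: "length xs = n" by (simp add: tbasis_def)
  have "ent (dg h * A) xs xs = (\<Sum>zs\<in>tbasis n. if xs = zs then prod_list (map h xs) * ent A xs xs else 0)"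
    unfolding ent_times n using xs n by (intro sum.cong refl) (auto simp: ent_dg)
  then show ?thesis using xs by simp
qed

lemma markov_trace_Suc: "markov_trace h (Suc m) A = (\<Sum>x\<in>letters. tr m (dg h * blk x x A))"
  unfolding markov_trace_def sum_tbasis_Suc tr_def by (intro sum.cong refl) (simp add: ent_dg_times)

lemma braid_invariant_markov_trace:
  assumes "braid_word n w" "Rinv4 R = M" "n \<ge> 1"
  shows "braid_invariant R h n w = markov_trace h n (rhop R M w) / 4"
proof -
  have "(\<Prod>p\<in>{1..<n}. h (xs ! p)) = prod_list (map h (tl xs))" if xs: "xs \<in> tbasis n" for xs
  proof -
    obtain m where m: "n = Suc m" using assms(3) by (cases n) auto
    then obtain x ys where xs: "xs = x # ys" "length ys = m"
      using xs by (cases xs) (auto simp: tbasis_def)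
    have "(\<Prod>p\<in>{1..<n}. h (xs ! p)) = (\<Prod>p\<in>{0..<m}. h (xs ! Suc p))"
      unfolding m One_nat_def by (rule prod.shift_bounds_Suc_ivl)
    then show ?thesis using xs by (simp add: prod.list_conv_set_nth)
  qed
  then show ?thesis
    unfolding braid_invariant_def markov_trace_def
    using rho_eq_ent_rhop [OF assms(1,2)] by (auto intro!: sum.cong)
qed

context
  fixes s t :: "'a::field"
  assumes st: "s \<noteq> 0" "t \<noteq> 0"
begin

lemma rhop_RV_delta:
  assumes "braid_word n w" "character k"
    and "peq (pmul (\<lambda>kl ij. ptens X (ldiag (\<lambda>_. 1)) kl ij + ptens (ldiag k) X kl ij) (coeff_of (RV_img s t)))
      (pmul (coeff_of (RV_img s t)) (\<lambda>kl ij. ptens X (ldiag (\<lambda>_. 1)) kl ij + ptens (ldiag k) X kl ij))"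
  shows "delta X k (\<lambda>_. 1) * rhop (coeff_of (RV_img s t)) (coeff_of (RV_inv_img s t)) w
    = rhop (coeff_of (RV_img s t)) (coeff_of (RV_inv_img s t)) w * delta X k (\<lambda>_. 1)"
proof (rule rhop_commute [OF _ _ assms(1)])
  fix i :: nat assume i: "i \<ge> 1"
  show *: "delta X k (\<lambda>_. 1) * genop (coeff_of (RV_img s t)) i = genop (coeff_of (RV_img s t)) i * delta X k (\<lambda>_. 1)"
    by (rule delta_commute_genop [OF wt_preserving_imgs(1) assms(2) _ i assms(3)]) (simp add: character_def)
  show "delta X k (\<lambda>_. 1) * genop (coeff_of (RV_inv_img s t)) i = genop (coeff_of (RV_inv_img s t)) i * delta X k (\<lambda>_. 1)"
    by (rule genop_commute_inverse [OF * RV_inverse [OF st] i])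
qed

text \<open>The coproduct of \<open>fmat\<close> equates the traces at the letters 1, 2 and at 3, 4;
  that of \<open>zmat\<close> equates those at 1 and 3.\<close>

lemma partial_trace_RV_scalar:
  assumes "braid_word n w" "x \<in> letters"
  defines "A \<equiv> rhop (coeff_of (RV_img s t)) (coeff_of (RV_inv_img s t)) w"
  shows "tr m (dg hV * blk x x A) = tr m (dg hV * blk 1 1 A)"
proof -
  have f: "delta fmat kchar (\<lambda>_. 1) * A = A * delta fmat kchar (\<lambda>_. 1)"
    unfolding A_def by (rule rhop_RV_delta [OF assms(1) _ phi_commutes_RV [OF st]]) (simp add: character_def kchar_def)
  have z: "delta zmat (zchar t) (\<lambda>_. 1) * A = A * delta zmat (zchar t) (\<lambda>_. 1)"
    unfolding A_def by (rule rhop_RV_delta [OF assms(1) _ zeta_commutes_RV [OF st]]) (simp add: character_def zchar_def)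
  have "tr m (dg hV * blk 2 2 A) = tr m (dg hV * blk 1 1 A)" "tr m (dg hV * blk 4 4 A) = tr m (dg hV * blk 3 3 A)"
    by (rule partial_trace_eq [OF f]; simp add: fmat_def kchar_def hV_def)+
  moreover have "tr m (dg hV * blk 1 1 A) = tr m (dg hV * blk 3 3 A)"
    by (rule partial_trace_eq [OF z]; simp add: zmat_def zchar_def hV_def)
  ultimately show ?thesis using assms(2) by (auto simp: letter_cases)
qed

text \<open>\<open>J\<close> conjugates one representation into the other, and the two weighted
  traces already agree for each first letter separately.\<close>

lemma markov_trace_RV_RT:
  assumes "braid_word (Suc m) w"
  shows "markov_trace hV (Suc m) (rhop (coeff_of (RV_img s t)) (coeff_of (RV_inv_img s t)) w)
    = markov_trace (\<lambda>x. hV x * inverse (gchar s t x)) (Suc m) (rhop (coeff_of (RT_img s t)) (coeff_of (RT_inv_img s t)) w)"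
proof -
  let ?V = "rhop (coeff_of (RV_img s t)) (coeff_of (RV_inv_img s t)) w"
  let ?T = "rhop (coeff_of (RT_img s t)) (coeff_of (RT_inv_img s t)) w"
  have chars: "character (kchar :: nat \<Rightarrow> 'a)" "character (gchar s t)" "character (\<lambda>_. 1 :: 'a)"
    by (simp_all add: character_def kchar_def gchar_def)
  have e: "eps s t * genop (coeff_of (RT_img s t)) i = genop (coeff_of (RT_img s t)) i * eps s t" if "i \<ge> 1" for i
    by (rule delta_commute_genop [OF wt_preserving_imgs(2) chars(1,3) that eps_commutes [OF st]])
  have f: "phi s t * genop (coeff_of (RT_img s t)) i = genop (coeff_of (RT_img s t)) i * phi s t" if "i \<ge> 1" for i
    by (rule delta_commute_genop [OF wt_preserving_imgs(2) chars(1,2) that phi_commutes [OF st]])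
  have j: "Jop s t * genop (coeff_of (RT_img s t)) i = genop (coeff_of (RV_img s t)) i * Jop s t" if "i \<ge> 1" for i
    by (rule Jop_genop [OF e F_intertwines [OF st] B_intertwines [OF st] that])
  have "phi s t * ?T = ?T * phi s t"
    by (rule rhop_commute [OF _ _ assms]) (blast intro: f genop_commute_inverse RT_inverse [OF st])+
  moreover have "Jop s t * ?T = ?V * Jop s t"
    by (rule rhop_commute [OF _ _ assms])
      (blast intro: j genop_commute_inverse RT_inverse(1) [OF st] RV_inverse(2) [OF st])+
  then have "Jop s t * ?T * Jop_inv s t = ?V * (Jop s t * Jop_inv s t)"
    by (simp add: mult.assoc)
  then have "?V = Jop s t * ?T * Jop_inv s t"
    by (simp add: Jop_Jop_inv)
  ultimately show ?thesis
    unfolding markov_trace_Suc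
    by (intro sum.cong refl) (simp only: twisted_partial_trace [OF _ st])
qed

end

section \<open>From the Links--Gould matrix to the twisted matrix\<close>

text \<open>The position in the basis \<open>w\<close> of the vector identified with \<open>v\<^sub>x\<close>.\<close>

definition relabel :: "nat \<Rightarrow> nat" where
  "relabel x = (if x = 1 then 3 else if x = 2 then 1 else if x = 3 then 4 else 2)"

lemma bij_betw_map_relabel: "bij_betw (map relabel) (tbasis n) (tbasis n)"
proof -
  have inj: "inj_on relabel letters" by (auto simp: inj_on_def relabel_def letter_cases)
  have im: "relabel x \<in> letters" for x by (simp add: relabel_def)
  have "inj_on (map relabel) (tbasis n)"
    using inj by (intro inj_on_mapI) (auto simp: tbasis_def letters_def inj_on_def)
  moreover have "map relabel ` tbasis n \<subseteq> tbasis n"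
    using im by (auto simp: tbasis_def letters_def)
  ultimately show ?thesis
    by (simp add: bij_betw_def endo_inj_surj)
qed

section \<open>Gauge factors and degrees of words\<close>

definition num3 :: "nat list \<Rightarrow> nat" where
  "num3 xs = (\<Sum>x\<leftarrow>xs. if x = 3 then 1 else 0)"

definition wtP :: "nat list \<Rightarrow> nat" where
  "wtP xs = sum_list (map wtp xs)"

definition wtQ :: "nat list \<Rightarrow> nat" where
  "wtQ xs = sum_list (map wtq xs)"

lemma wt_simps [simp]:
  "num3 [] = 0" "num3 (x # xs) = (if x = 3 then 1 else 0) + num3 xs"
  "wtP [] = 0" "wtP (x # xs) = wtp x + wtP xs" "wtQ [] = 0" "wtQ (x # xs) = wtq x + wtQ xs"
  by (simp_all add: num3_def wtP_def wtQ_def)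

text \<open>Truncated subtraction: at most one of the two exponents is positive.\<close>

definition scal :: "'a::field \<Rightarrow> 'a \<Rightarrow> nat \<Rightarrow> nat \<Rightarrow> 'a" where
  "scal l m i j = m ^ (i - j) * l ^ (j - i)"

lemma scal_same [simp]: "scal l m i i = 1"
  by (simp add: scal_def)

lemma scal_add [simp]: "scal l m (k + i) (k + j) = scal l m i j"
  by (simp add: scal_def)

lemma scal_times:
  "scal l m i j * scal l m j k = (l * m) ^ ((i - j) + (j - k) - (i - k)) * scal l m i k"
proof -
  define e where "e = (i - j) + (j - k) - (i - k)"
  have e: "(i - j) + (j - k) = e + (i - k)" "(j - i) + (k - j) = e + (k - i)"
    unfolding e_def by linarith+
  have "scal l m i j * scal l m j k = m ^ ((i - j) + (j - k)) * l ^ ((j - i) + (k - j))"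
    by (simp add: scal_def power_add mult_ac)
  also have "\<dots> = m ^ (e + (i - k)) * l ^ (e + (k - i))"
    by (simp only: e)
  also have "\<dots> = (l * m) ^ e * scal l m i k"
    by (simp add: scal_def power_add power_mult_distrib mult_ac)
  finally show ?thesis by (simp only: e_def)
qed

text \<open>The factor of a letter \<open>x\<close> followed by letters of total bidegree
  \<open>(p, q)\<close>. Only the first power depends on \<open>x\<close>; the other two accumulate,
  for each letter, one factor per strand before it.\<close>

definition gauge2 :: "'a::field \<Rightarrow> 'a \<Rightarrow> nat \<Rightarrow> nat \<Rightarrow> nat \<Rightarrow> 'a" where
  "gauge2 a b x p q = (- (a * b)) ^ (wtq x * p) * (- inverse a) ^ p * (- inverse b) ^ q"

primrec gauge :: "'a::field \<Rightarrow> 'a \<Rightarrow> nat list \<Rightarrow> 'a" where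
  "gauge a b [] = 1"
| "gauge a b (x # xs) = gauge2 a b x (wtP xs) (wtQ xs) * gauge a b xs"

lemma gauge_nonzero: "a \<noteq> 0 \<Longrightarrow> b \<noteq> 0 \<Longrightarrow> gauge a b xs \<noteq> 0"
  by (induction xs) (simp_all add: gauge2_def)

text \<open>The factor relating the two leading letters to the tail depends on these letters only
  through \<open>wtq x + wtq x'\<close>, hence is unaffected by a weight-preserving matrix.\<close>

lemma gauge_Cons_Cons:
  "gauge a b (x # x' # xs) = gauge2 a b x (wtp x') (wtq x') *
    ((- (a * b)) ^ ((wtq x + wtq x') * wtP xs) * ((- inverse a) ^ wtP xs * (- inverse a) ^ wtP xs) * ((- inverse b) ^ wtQ xs * (- inverse b) ^ wtQ xs) * gauge a b xs)"
  by (simp only: gauge.simps gauge2_def wt_simps power_add distrib_left distrib_right mult_ac)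

text \<open>Matching the two matrices requires rescaling one basis vector by a factor that degenerates for \<open>y = 0\<close>.
  So the gauge transformation is not applied as a conjugation: both matrices are compared with a common
  \<open>g\<close>, homogeneous for the number of letters \<open>3\<close>, in which only the product \<open>l * m = y * y\<close> enters.\<close>

definition gauge_rel :: "'a::field \<Rightarrow> 'a \<Rightarrow> 'a \<Rightarrow> 'a \<Rightarrow> 'a \<Rightarrow> 'a op \<Rightarrow> 'a op \<Rightarrow> bool" where
  "gauge_rel a b y l m A B \<longleftrightarrow> (\<exists>g. \<forall>n. \<forall>us\<in>tbasis n. \<forall>xs\<in>tbasis n.
     ent A (map relabel us) (map relabel xs) = scal y y (num3 us) (num3 xs) * g us xs \<and>
     gauge a b xs * ent B us xs = gauge a b us * scal l m (num3 us) (num3 xs) * g us xs \<and>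
     (g us xs \<noteq> 0 \<longrightarrow> wtP us = wtP xs \<and> wtQ us = wtQ xs))"

lemma map_relabel_in_tbasis: "xs \<in> tbasis n \<Longrightarrow> map relabel xs \<in> tbasis n"
  using bij_betw_map_relabel by (auto simp: bij_betw_def)

lemma map_relabel_eq: "us \<in> tbasis n \<Longrightarrow> xs \<in> tbasis n \<Longrightarrow> map relabel us = map relabel xs \<longleftrightarrow> us = xs"
  using bij_betw_map_relabel [of n] by (auto simp: bij_betw_def inj_on_def)

lemma gauge_rel_one:
  fixes a :: "'a::field"
  shows "gauge_rel a b y l m 1 1"
  unfolding gauge_rel_def
proof (intro exI [of _ "\<lambda>us xs. if us = xs then 1 else 0"] allI ballI)
  fix n us xs assume us: "us \<in> tbasis n" and xs: "xs \<in> tbasis n"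
  have "length xs = n" using xs by (simp add: tbasis_def)
  then have "ent 1 us xs = (if us = xs then 1 else 0 :: 'a)"
    "ent 1 (map relabel us) (map relabel xs) = (if us = xs then 1 else 0 :: 'a)"
    using map_relabel_in_tbasis [OF xs] xs by (simp_all add: ent_one map_relabel_eq [OF us xs])
  then show "ent 1 (map relabel us) (map relabel xs) = scal y y (num3 us) (num3 xs) * (if us = xs then 1 else 0) \<and>
      gauge a b xs * ent 1 us xs = gauge a b us * scal l m (num3 us) (num3 xs) * (if us = xs then 1 else 0) \<and>
      ((if us = xs then 1 else 0 :: 'a) \<noteq> 0 \<longrightarrow> wtP us = wtP xs \<and> wtQ us = wtQ xs)"
    by simp
qed

text \<open>Intermediate words contribute extra powers of \<open>y * y\<close> on one side and of
  \<open>l * m\<close> on the other. These coincide by \<open>lm\<close>, so a single function again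
  describes both products.\<close>

lemma gauge_rel_times:
  assumes lm: "l * m = y * y" and "gauge_rel a b y l m A B" "gauge_rel a b y l m A' B'"
  shows "gauge_rel a b y l m (A * A') (B * B')"
proof -
  let ?N = num3
  obtain g where g: "\<And>n us xs. us \<in> tbasis n \<Longrightarrow> xs \<in> tbasis n \<Longrightarrow>
      ent A (map relabel us) (map relabel xs) = scal y y (?N us) (?N xs) * g us xs \<and>
      gauge a b xs * ent B us xs = gauge a b us * scal l m (?N us) (?N xs) * g us xs \<and>
      (g us xs \<noteq> 0 \<longrightarrow> wtP us = wtP xs \<and> wtQ us = wtQ xs)"
    using assms(2) unfolding gauge_rel_def by blast
  obtain g' where g': "\<And>n us xs. us \<in> tbasis n \<Longrightarrow> xs \<in> tbasis n \<Longrightarrow>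
      ent A' (map relabel us) (map relabel xs) = scal y y (?N us) (?N xs) * g' us xs \<and>
      gauge a b xs * ent B' us xs = gauge a b us * scal l m (?N us) (?N xs) * g' us xs \<and>
      (g' us xs \<noteq> 0 \<longrightarrow> wtP us = wtP xs \<and> wtQ us = wtQ xs)"
    using assms(3) unfolding gauge_rel_def by blast
  define e where "e i j k = (i - j) + (j - k) - (i - k)" for i j k :: nat
  define G where "G us xs = (\<Sum>zs\<in>tbasis (length xs). (y * y) ^ e (?N us) (?N zs) (?N xs) * (g us zs * g' zs xs))"
    for us xs
  have sc: "scal y y i j * scal y y j k = (y * y) ^ e i j k * scal y y i k"
    "scal l m i j * scal l m j k = (y * y) ^ e i j k * scal l m i k" for i j k
    by (simp_all add: scal_times e_def lm)
  show ?thesis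
    unfolding gauge_rel_def
  proof (intro exI [of _ G] allI ballI conjI impI)
    fix n us xs assume us: "us \<in> tbasis n" and xs: "xs \<in> tbasis n"
    have n: "length xs = n" using xs by (simp add: tbasis_def)
    have "ent (A * A') (map relabel us) (map relabel xs)
        = (\<Sum>zs\<in>tbasis n. ent A (map relabel us) zs * ent A' zs (map relabel xs))"
      by (simp add: ent_times n)
    also have "\<dots> = (\<Sum>zs\<in>tbasis n. ent A (map relabel us) (map relabel zs) * ent A' (map relabel zs) (map relabel xs))"
      by (rule sum.reindex_bij_betw [OF bij_betw_map_relabel, symmetric])
    also have "\<dots> = (\<Sum>zs\<in>tbasis n. (scal y y (?N us) (?N zs) * scal y y (?N zs) (?N xs)) * (g us zs * g' zs xs))"
      using us xs g g' by (intro sum.cong refl) simp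
    also have "\<dots> = scal y y (?N us) (?N xs) * G us xs"
      unfolding sc by (simp add: G_def n sum_distrib_left algebra_simps)
    finally show "ent (A * A') (map relabel us) (map relabel xs) = scal y y (?N us) (?N xs) * G us xs" .
    have "gauge a b xs * ent (B * B') us xs = (\<Sum>zs\<in>tbasis n. ent B us zs * (gauge a b xs * ent B' zs xs))"
      by (simp add: ent_times n sum_distrib_left algebra_simps)
    also have "\<dots> = (\<Sum>zs\<in>tbasis n. (gauge a b zs * ent B us zs) * (scal l m (?N zs) (?N xs) * g' zs xs))"
      using us xs g' by (intro sum.cong refl) (simp add: algebra_simps)
    also have "\<dots> = (\<Sum>zs\<in>tbasis n. gauge a b us * ((scal l m (?N us) (?N zs) * scal l m (?N zs) (?N xs)) * (g us zs * g' zs xs)))"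
      using us xs g by (intro sum.cong refl) (simp add: algebra_simps)
    also have "\<dots> = gauge a b us * scal l m (?N us) (?N xs) * G us xs"
      unfolding sc by (simp add: G_def n sum_distrib_left algebra_simps)
    finally show "gauge a b xs * ent (B * B') us xs = gauge a b us * scal l m (?N us) (?N xs) * G us xs" .
    assume "G us xs \<noteq> 0"
    then obtain zs where "zs \<in> tbasis n" "g us zs * g' zs xs \<noteq> 0"
      unfolding G_def n by (metis (no_types, lifting) mult_zero_right sum.neutral)
    then show "wtP us = wtP xs" "wtQ us = wtQ xs"
      using us xs g [of us n zs] g' [of zs n xs] by simp_all
  qed
qed

lemma tbasis_cases:
  assumes "us \<in> tbasis n" "xs \<in> tbasis n"
  obtains (Nil) "us = []" "xs = []" "n = 0"
  | (Cons) n' u us' x xs' where "n = Suc n'" "us = u # us'" "xs = x # xs'"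
      "u \<in> letters" "x \<in> letters" "us' \<in> tbasis n'" "xs' \<in> tbasis n'"
proof (cases n)
  case 0
  then show ?thesis using assms that(1) by (simp add: tbasis_0)
next
  case (Suc n')
  then show ?thesis using assms that(2) by (metis tbasis_Suc_cases)
qed

lemma relabel_letters [simp]: "relabel x \<in> letters"
  by (simp add: relabel_def)

lemma relabel_eq_iff: "u \<in> letters \<Longrightarrow> x \<in> letters \<Longrightarrow> relabel u = relabel x \<longleftrightarrow> u = x"
  by (auto simp: relabel_def letter_cases)

lemma gauge_rel_sh:
  assumes "gauge_rel a b y l m A B"
  shows "gauge_rel a b y l m (sh A) (sh B)"
proof -
  obtain g where g: "\<And>n us xs. us \<in> tbasis n \<Longrightarrow> xs \<in> tbasis n \<Longrightarrow>
      ent A (map relabel us) (map relabel xs) = scal y y (num3 us) (num3 xs) * g us xs \<and>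
      gauge a b xs * ent B us xs = gauge a b us * scal l m (num3 us) (num3 xs) * g us xs \<and>
      (g us xs \<noteq> 0 \<longrightarrow> wtP us = wtP xs \<and> wtQ us = wtQ xs)"
    using assms unfolding gauge_rel_def by blast
  define G where "G us xs = (if us = [] then 1 else if hd us = hd xs then g (tl us) (tl xs) else 0)" for us xs
  show ?thesis
    unfolding gauge_rel_def
  proof (intro exI [of _ G] allI ballI)
    fix n us xs assume "us \<in> tbasis n" "xs \<in> tbasis n"
    then show "ent (sh A) (map relabel us) (map relabel xs) = scal y y (num3 us) (num3 xs) * G us xs \<and>
      gauge a b xs * ent (sh B) us xs = gauge a b us * scal l m (num3 us) (num3 xs) * G us xs \<and>
      (G us xs \<noteq> 0 \<longrightarrow> wtP us = wtP xs \<and> wtQ us = wtQ xs)"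
    proof (cases rule: tbasis_cases)
      case Nil
      then show ?thesis by (simp add: sh_def ent_emp G_def)
    next
      case (Cons n' u us' x xs')
      note gg = g [OF Cons(6,7)]
      show ?thesis
      proof (cases "u = x")
        case True
        have "gauge a b xs * ent (sh B) us xs = gauge2 a b x (wtP xs') (wtQ xs') * (gauge a b xs' * ent B us' xs')"
          using Cons True by (simp add: sh_def ent_emp lid_def)
        also have "\<dots> = gauge2 a b x (wtP xs') (wtQ xs') * (gauge a b us' * scal l m (num3 us') (num3 xs') * g us' xs')"
          using gg by simp
        \<comment> \<open>The idle letter sees only the bidegree of the tail, which \<open>g\<close>
          preserves wherever it is nonzero.\<close>
        also have "\<dots> = gauge2 a b x (wtP us') (wtQ us') * (gauge a b us' * scal l m (num3 us') (num3 xs') * g us' xs')"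
          using gg by (cases "g us' xs' = 0") simp_all
        finally show ?thesis
          using Cons True gg by (simp add: sh_def ent_emp lid_def G_def)
      next
        case False
        then show ?thesis
          using Cons by (simp add: sh_def ent_emp lid_def G_def relabel_eq_iff)
      qed
    qed
  qed
qed

section \<open>Reduction of the gauge comparison to two strands\<close>

definition pair_gauge_rel :: "'a::field \<Rightarrow> 'a \<Rightarrow> 'a \<Rightarrow> 'a \<Rightarrow> 'a \<Rightarrow>
    (nat \<times> nat \<Rightarrow> nat \<times> nat \<Rightarrow> 'a) \<Rightarrow> (nat \<times> nat \<Rightarrow> nat \<times> nat \<Rightarrow> 'a) \<Rightarrow> (nat \<times> nat \<Rightarrow> nat \<times> nat \<Rightarrow> 'a) \<Rightarrow> bool" where
  "pair_gauge_rel a b y l m g R Q \<longleftrightarrow> (\<forall>ij\<in>pairs4. \<forall>kl\<in>pairs4.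
     R (map_prod relabel relabel kl) (map_prod relabel relabel ij)
       = scal y y (num3 [fst kl, snd kl]) (num3 [fst ij, snd ij]) * g kl ij \<and>
     gauge2 a b (fst ij) (wtp (snd ij)) (wtq (snd ij)) * Q kl ij
       = gauge2 a b (fst kl) (wtp (snd kl)) (wtq (snd kl))
         * scal l m (num3 [fst kl, snd kl]) (num3 [fst ij, snd ij]) * g kl ij \<and>
     (g kl ij \<noteq> 0 \<longrightarrow> wtp (fst kl) + wtp (snd kl) = wtp (fst ij) + wtp (snd ij) \<and>
       wtq (fst kl) + wtq (snd kl) = wtq (fst ij) + wtq (snd ij)))"

lemma gauge_rel_pairop:
  fixes a :: "'a::field"
  assumes "pair_gauge_rel a b y l m g R Q"
  shows "gauge_rel a b y l m (pairop R) (pairop Q)"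
proof -
  \<comment> \<open>The default case covers words with fewer than two letters, on which
    \<open>pairop\<close> is the identity.\<close>
  define G where "G us xs = (case (us, xs) of
      (k # k' # us', i # i' # xs') \<Rightarrow> if us' = xs' then g (k, k') (i, i') else 0
    | _ \<Rightarrow> if us = xs then 1 else 0)" for us xs
  show ?thesis
    unfolding gauge_rel_def
  proof (intro exI [of _ G] allI ballI)
    fix n us xs assume us: "us \<in> tbasis n" and xs: "xs \<in> tbasis n"
    then show "ent (pairop R) (map relabel us) (map relabel xs) = scal y y (num3 us) (num3 xs) * G us xs \<and>
      gauge a b xs * ent (pairop Q) us xs = gauge a b us * scal l m (num3 us) (num3 xs) * G us xs \<and>
      (G us xs \<noteq> 0 \<longrightarrow> wtP us = wtP xs \<and> wtQ us = wtQ xs)"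
    proof (cases rule: tbasis_cases)
      case Nil
      then show ?thesis by (simp add: pairop_def ent_emp G_def)
    next
      case (Cons n' k us1 i xs1)
      note c1 = Cons
      from Cons(6,7) show ?thesis
      proof (cases rule: tbasis_cases)
        case Nil
        then show ?thesis
          using c1 by (simp add: pairop_def ent_emp G_def lid_def relabel_eq_iff)
      next
        case (Cons n2 k' us' i' xs')
        have p: "(k, k') \<in> pairs4" "(i, i') \<in> pairs4" using c1 Cons by (simp_all add: pairs4_letters)
        have len: "length us' = n2" "length xs' = n2" "set us' \<subseteq> {1..4}" "set xs' \<subseteq> {1..4}"
          using Cons by (auto simp: tbasis_def)
        have e1: "ent 1 us' xs' = (if us' = xs' then 1 else 0 :: 'a)"
          "ent 1 (map relabel us') (map relabel xs') = (if us' = xs' then 1 else 0 :: 'a)"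
          using Cons(6,7) len map_relabel_in_tbasis [OF Cons(7)]
          by (auto simp: ent_one map_relabel_eq [OF Cons(6,7)])
        have pq: "R (relabel k, relabel k') (relabel i, relabel i')
            = scal y y (num3 [k, k']) (num3 [i, i']) * g (k, k') (i, i')"
          "gauge2 a b i (wtp i') (wtq i') * Q (k, k') (i, i')
            = gauge2 a b k (wtp k') (wtq k') * scal l m (num3 [k, k']) (num3 [i, i']) * g (k, k') (i, i')"
          "g (k, k') (i, i') \<noteq> 0 \<longrightarrow> wtp k + wtp k' = wtp i + wtp i' \<and> wtq k + wtq k' = wtq i + wtq i'"
          using assms p unfolding pair_gauge_rel_def by force+
        show ?thesis
        proof (cases "us' = xs'")
          case False
          then show ?thesis
            using c1 Cons p by (simp add: pairop_def ent_emp G_def e1)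
        next
          case True
          have n3: "num3 us = num3 xs' + num3 [k, k']" "num3 xs = num3 xs' + num3 [i, i']"
            using c1 Cons True by simp_all
          have "gauge a b xs * Q (k, k') (i, i')
             = (gauge2 a b i (wtp i') (wtq i') * Q (k, k') (i, i')) *
               ((- (a * b)) ^ ((wtq i + wtq i') * wtP xs') * ((- inverse a) ^ wtP xs' * (- inverse a) ^ wtP xs') * ((- inverse b) ^ wtQ xs' * (- inverse b) ^ wtQ xs') * gauge a b xs')"
            using c1 Cons by (simp only: gauge_Cons_Cons) (simp add: mult_ac)
          \<comment> \<open>Where \<open>g\<close> is nonzero the weights agree, and so do the
            factors relating the two letters to the tail; where it vanishes both sides are
            0.\<close>
          also have "\<dots> = (gauge2 a b k (wtp k') (wtq k') * scal l m (num3 [k, k']) (num3 [i, i']) * g (k, k') (i, i')) *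
               ((- (a * b)) ^ ((wtq k + wtq k') * wtP xs') * ((- inverse a) ^ wtP xs' * (- inverse a) ^ wtP xs') * ((- inverse b) ^ wtQ xs' * (- inverse b) ^ wtQ xs') * gauge a b xs')"
            using pq by (cases "g (k, k') (i, i') = 0") simp_all
          also have "\<dots> = gauge a b us * scal l m (num3 [k, k']) (num3 [i, i']) * g (k, k') (i, i')"
            using c1 Cons True by (simp only: gauge_Cons_Cons) (simp add: mult_ac)
          finally show ?thesis
            using c1 Cons p True pq(1,3) unfolding n3 scal_add
            by (auto simp: pairop_def ent_emp G_def e1 [unfolded True] pairs4_letters simp del: wt_simps(2) gauge.simps)
        qed
      qed
    qed
  qed
qed

lemma gauge_rel_genop:
  assumes "pair_gauge_rel a b y l m g R Q" "i \<ge> 1"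
  shows "gauge_rel a b y l m (genop R i) (genop Q i)"
  using assms(2)
  by (induction i rule: dec_induct)
    (simp_all add: genop_1 genop_Suc gauge_rel_sh gauge_rel_pairop [OF assms(1)])

lemma gauge_rel_rhop:
  assumes "l * m = y * y" "pair_gauge_rel a b y l m g R Q" "pair_gauge_rel a b y l m g' R' Q'" "braid_word n w"
  shows "gauge_rel a b y l m (rhop R R' w) (rhop Q Q' w)"
  using assms(4)
proof (induction w)
  case (Cons z w)
  then show ?case
    by (cases "z > 0")
      (auto intro!: gauge_rel_times [OF assms(1)] gauge_rel_genop [OF assms(2)] gauge_rel_genop [OF assms(3)])
qed (simp add: gauge_rel_one)

text \<open>On the diagonal both \<open>scal\<close> factors are 1 and the gauge factor cancels, so
  the entries relevant for the trace agree even if \<open>y = 0\<close>.\<close>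

lemma gauge_rel_diag:
  assumes "gauge_rel a b y l m A B" "a \<noteq> 0" "b \<noteq> 0" "xs \<in> tbasis n"
  shows "ent A (map relabel xs) (map relabel xs) = ent B xs xs"
proof -
  obtain g where "ent A (map relabel xs) (map relabel xs) = g xs xs" "gauge a b xs * ent B xs xs = gauge a b xs * g xs xs"
    using assms(1,4) unfolding gauge_rel_def by (metis scal_same mult_1 mult.right_neutral)
  then show ?thesis using gauge_nonzero [OF assms(2,3)] by simp
qed

definition pnum3 :: "nat \<times> nat \<Rightarrow> nat" where
  "pnum3 kl = num3 [fst kl, snd kl]"

text \<open>After relabelling, the entries that change the number of letters 3 are \<open>y\<close>
  times an expression free of \<open>y\<close>, so \<open>g\<close> is obtained by setting
  \<open>y\<close> to 1 there. The two factors of \<open>y^2\<close> are split between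
  \<open>l\<close>, for entries lowering that number, and \<open>m\<close>, for entries raising
  it.\<close>

lemma pair_gauge_rel_RLG:
  fixes a b y :: "'a::field"
  assumes "a \<noteq> 0" "b \<noteq> 0" and y: "y^2 = (a^2 - 1) * (1 - b^2)"
  defines "l \<equiv> (a^2 - 1) * (a * b^2)" and "m \<equiv> (1 - b^2) * inverse (a * b^2)"
  shows "pair_gauge_rel a b y l m
      (\<lambda>kl ij. coeff_of (RLG_img a b (if pnum3 kl = pnum3 ij then y else 1)) (map_prod relabel relabel kl) (map_prod relabel relabel ij))
      (coeff_of (RLG_img a b y)) (coeff_of (RT_img (a^2) (b^2)))"
    and "pair_gauge_rel a b y l m
      (\<lambda>kl ij. coeff_of (RLG_inv_img a b (if pnum3 kl = pnum3 ij then y else 1)) (map_prod relabel relabel kl) (map_prod relabel relabel ij))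
      (coeff_of (RLG_inv_img a b y)) (coeff_of (RT_inv_img (a^2) (b^2)))"
proof -
  define A B where AB: "A = inverse a" "B = inverse b"
  have A: "a * A = 1" and B: "b * B = 1" using assms by (simp_all add: AB)
  have nz: "A \<noteq> 0" "B \<noteq> 0" using assms by (simp_all add: AB)
  have inv: "inverse (a^2) = A^2" "inverse (b^2) = B^2" "inverse (a * b) = A * B"
    "inverse (a^2 * b^2) = A^2 * B^2" "inverse a = A" "inverse b = B" "inverse (a * b^2) = A * B^2"
    by (simp_all add: AB power_inverse)
  note ev = coeff_of_def gauge2_def scal_def pnum3_def relabel_def wtp_def wtq_def Let_def
  show "pair_gauge_rel a b y l m
      (\<lambda>kl ij. coeff_of (RLG_img a b (if pnum3 kl = pnum3 ij then y else 1)) (map_prod relabel relabel kl) (map_prod relabel relabel ij))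
      (coeff_of (RLG_img a b y)) (coeff_of (RT_img (a^2) (b^2)))"
    unfolding pair_gauge_rel_def ball_pairs4 l_def m_def
    apply (simp add: ev RLG_img_def RT_img_def inv nz assms(1,2))
    apply (intro conjI; use A B y in algebra)
    done
  show "pair_gauge_rel a b y l m
      (\<lambda>kl ij. coeff_of (RLG_inv_img a b (if pnum3 kl = pnum3 ij then y else 1)) (map_prod relabel relabel kl) (map_prod relabel relabel ij))
      (coeff_of (RLG_inv_img a b y)) (coeff_of (RT_inv_img (a^2) (b^2)))"
    unfolding pair_gauge_rel_def ball_pairs4 l_def m_def
    apply (simp add: ev RLG_inv_img_def RT_inv_img_def inv nz assms(1,2))
    apply (intro conjI; (simp add: power2_eq_square; fail | use A B in algebra | use A B y in algebra))
    done
qed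

lemma markov_trace_relabel:
  assumes "\<And>xs. xs \<in> tbasis n \<Longrightarrow> ent A (map relabel xs) (map relabel xs) = ent B xs xs"
    and "\<And>x. x \<in> letters \<Longrightarrow> h (relabel x) = h' x"
  shows "markov_trace h n A = markov_trace h' n B"
proof -
  have "map h (tl (map relabel xs)) = map h' (tl xs)" if "xs \<in> tbasis n" for xs
  proof -
    have "set (tl xs) \<subseteq> letters"
      using that by (cases xs) (auto simp: tbasis_def letters_def)
    then show ?thesis using assms(2) by (auto simp: map_tl [symmetric])
  qed
  then have "(\<Sum>xs\<in>tbasis n. prod_list (map h (tl (map relabel xs))) * ent A (map relabel xs) (map relabel xs))
      = markov_trace h' n B"
    unfolding markov_trace_def using assms(1) by (intro sum.cong refl) simp
  then show ?thesis
    unfolding markov_trace_def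
    by (simp only: sum.reindex_bij_betw [OF bij_betw_map_relabel, of "\<lambda>xs. prod_list (map h (tl xs)) * ent A xs xs"])
qed

lemma V1_inv_eq_LG_inv:
  fixes a b y :: "'a::field"
  assumes n: "n \<ge> 1" and w: "braid_word n w"
    and ab: "a \<noteq> 0" "b \<noteq> 0" and y: "y^2 = (a^2 - 1) * (1 - b^2)"
  shows "V1_inv (a^2) (b^2) n w = LG_inv a b y n w"
proof -
  obtain m where m: "n = Suc m" using n by (cases n) auto
  let ?s = "a^2" and ?t = "b^2"
  have st: "?s \<noteq> 0" "?t \<noteq> 0" using ab by simp_all
  have lm: "(a^2 - 1) * (a * b^2) * ((1 - b^2) * inverse (a * b^2)) = y * y"
    using ab by (simp add: power2_eq_square [of y, symmetric] y) (simp add: field_simps)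
  let ?L = "rhop (coeff_of (RLG_img a b y)) (coeff_of (RLG_inv_img a b y)) w"
  let ?T = "rhop (coeff_of (RT_img ?s ?t)) (coeff_of (RT_inv_img ?s ?t)) w"
  have "ent ?L (map relabel xs) (map relabel xs) = ent ?T xs xs" if "xs \<in> tbasis n" for xs
    by (rule gauge_rel_diag [OF gauge_rel_rhop [OF lm pair_gauge_rel_RLG [OF ab y] w] ab that])
  then have "markov_trace (hLG a b) n ?L = markov_trace (\<lambda>x. hV x * inverse (gchar ?s ?t x)) n ?T"
    by (rule markov_trace_relabel) (auto simp: letter_cases relabel_def hLG_def hV_def gchar_def Let_def)
  then show ?thesis
    unfolding V1_inv_def LG_inv_def braid_invariant_markov_trace [OF w Rinv4_RV [OF st] n]
      braid_invariant_markov_trace [OF w Rinv4_RLG [OF ab y] n]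
    using markov_trace_RV_RT [OF st, of m w] w m by simp
qed

section \<open>Laurent polynomials\<close>

definition laurent_monom :: "int \<times> int \<times> int \<Rightarrow> 'a::field \<Rightarrow> 'a \<Rightarrow> 'a" where
  "laurent_monom q s t = of_int (fst q) * s powi (fst (snd q)) * t powi (snd (snd q))"

text \<open>One list of integer monomials serves all nonzero arguments; this uniformity expresses
  that the function is a Laurent polynomial. Exponents may repeat in the list.\<close>

definition laurent :: "('a::field \<Rightarrow> 'a \<Rightarrow> 'a) \<Rightarrow> bool" where
  "laurent F \<longleftrightarrow> (\<exists>qs. \<forall>s t. s \<noteq> 0 \<longrightarrow> t \<noteq> 0 \<longrightarrow> F s t = (\<Sum>q\<leftarrow>qs. laurent_monom q s t))"

lemma laurent_laurent_monom: "laurent (laurent_monom q)"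
  unfolding laurent_def by (rule exI [of _ "[q]"]) simp

lemma laurent_cong: "(\<And>s t. s \<noteq> 0 \<Longrightarrow> t \<noteq> 0 \<Longrightarrow> F s t = G s t) \<Longrightarrow> laurent F \<Longrightarrow> laurent G"
  unfolding laurent_def by metis

lemma laurent_of_int: "laurent (\<lambda>_ _. of_int k)"
  by (rule laurent_cong [OF _ laurent_laurent_monom [of "(k, 0, 0)"]]) (simp add: laurent_monom_def)

lemma laurent_basic:
  "laurent (\<lambda>_ _. 0 :: 'a::field)" "laurent (\<lambda>_ _. 1 :: 'a)" "laurent (\<lambda>_ _. 2 :: 'a)"
  "laurent (\<lambda>s _. s :: 'a)" "laurent (\<lambda>_ t. t :: 'a)"
  "laurent (\<lambda>s _. inverse s :: 'a)" "laurent (\<lambda>_ t. inverse t :: 'a)"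
proof -
  show "laurent (\<lambda>_ _. 0 :: 'a)" "laurent (\<lambda>_ _. 1 :: 'a)" "laurent (\<lambda>_ _. 2 :: 'a)"
    using laurent_of_int [of 0, where ?'a = 'a] laurent_of_int [of 1, where ?'a = 'a]
      laurent_of_int [of 2, where ?'a = 'a] by simp_all
  show "laurent (\<lambda>s _. s :: 'a)"
    by (rule laurent_cong [OF _ laurent_laurent_monom [of "(1, 1, 0)"]]) (simp add: laurent_monom_def)
  show "laurent (\<lambda>_ t. t :: 'a)"
    by (rule laurent_cong [OF _ laurent_laurent_monom [of "(1, 0, 1)"]]) (simp add: laurent_monom_def)
  show "laurent (\<lambda>s _. inverse s :: 'a)"
    by (rule laurent_cong [OF _ laurent_laurent_monom [of "(1, - 1, 0)"]]) (simp add: laurent_monom_def power_int_minus)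
  show "laurent (\<lambda>_ t. inverse t :: 'a)"
    by (rule laurent_cong [OF _ laurent_laurent_monom [of "(1, 0, - 1)"]]) (simp add: laurent_monom_def power_int_minus)
qed

lemma laurent_add: "laurent F \<Longrightarrow> laurent G \<Longrightarrow> laurent (\<lambda>s t. F s t + G s t)"
  unfolding laurent_def
proof (elim exE)
  fix ps qs
  assume "\<forall>s t. s \<noteq> 0 \<longrightarrow> t \<noteq> 0 \<longrightarrow> F s t = (\<Sum>q\<leftarrow>ps. laurent_monom q s t)"
    "\<forall>s t. s \<noteq> 0 \<longrightarrow> t \<noteq> 0 \<longrightarrow> G s t = (\<Sum>q\<leftarrow>qs. laurent_monom q s t)"
  then show "\<exists>rs. \<forall>s t. s \<noteq> 0 \<longrightarrow> t \<noteq> 0 \<longrightarrow> F s t + G s t = (\<Sum>q\<leftarrow>rs. laurent_monom q s t)"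
    by (intro exI [of _ "ps @ qs"]) simp
qed

lemma laurent_mult:
  assumes "laurent F" "laurent G"
  shows "laurent (\<lambda>s t. F s t * G s t)"
proof -
  obtain ps qs where F: "\<And>s t. s \<noteq> 0 \<Longrightarrow> t \<noteq> 0 \<Longrightarrow> F s t = (\<Sum>q\<leftarrow>ps. laurent_monom q s t)"
    and G: "\<And>s t. s \<noteq> 0 \<Longrightarrow> t \<noteq> 0 \<Longrightarrow> G s t = (\<Sum>q\<leftarrow>qs. laurent_monom q s t)"
    using assms unfolding laurent_def by blast
  define mm :: "(int \<times> int \<times> int) \<Rightarrow> (int \<times> int \<times> int) \<Rightarrow> (int \<times> int \<times> int)"
    where "mm p q = (fst p * fst q, fst (snd p) + fst (snd q), snd (snd p) + snd (snd q))" for p q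
  have mm: "laurent_monom (mm p q) s t = laurent_monom p s t * laurent_monom q s t" if "s \<noteq> 0" "t \<noteq> 0" for p q and s t :: 'a
    using that by (simp add: laurent_monom_def mm_def power_int_add mult_ac)
  have "(\<Sum>q\<leftarrow>ps. laurent_monom q s t) * (\<Sum>q\<leftarrow>qs. laurent_monom q s t) = (\<Sum>q\<leftarrow>concat (map (\<lambda>p. map (mm p) qs) ps). laurent_monom q s t)"
    if "s \<noteq> 0" "t \<noteq> 0" for s t :: 'a
  proof (induction ps)
    case (Cons p ps)
    have "(\<Sum>q\<leftarrow>map (mm p) qs. laurent_monom q s t) = laurent_monom p s t * (\<Sum>q\<leftarrow>qs. laurent_monom q s t)"
      by (induction qs) (simp_all add: mm that distrib_left)
    then show ?case using Cons by (simp add: distrib_right del: map_map)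
  qed simp
  then show ?thesis
    unfolding laurent_def
    by (intro exI [of _ "concat (map (\<lambda>p. map (mm p) qs) ps)"]) (simp add: F G del: map_map)
qed

lemma laurent_uminus: "laurent F \<Longrightarrow> laurent (\<lambda>s t. - F s t)"
  using laurent_mult [OF laurent_of_int [of "-1"], of F] by simp

lemma laurent_diff: "laurent F \<Longrightarrow> laurent G \<Longrightarrow> laurent (\<lambda>s t. F s t - G s t)"
  using laurent_add [OF _ laurent_uminus, of F G] by simp

lemma laurent_if:
  "(P \<Longrightarrow> laurent F) \<Longrightarrow> (\<not> P \<Longrightarrow> laurent G) \<Longrightarrow> laurent (\<lambda>s t. if P then F s t else G s t)"
  by (cases P) simp_all

lemma laurent_sum: "(\<And>x. x \<in> S \<Longrightarrow> laurent (F x)) \<Longrightarrow> laurent (\<lambda>s t. \<Sum>x\<in>S. F x s t)"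
  by (induction S rule: infinite_finite_induct) (simp_all add: laurent_basic laurent_add)

lemmas laurent_intros = laurent_basic laurent_add laurent_uminus laurent_diff laurent_mult

text \<open>Monomials with equal exponents are merged by adding their integer coefficients.\<close>

lemma laurent_coefficients:
  fixes F :: "'a::field \<Rightarrow> 'a \<Rightarrow> 'a"
  assumes "laurent F"
  obtains c :: "int \<times> int \<Rightarrow> int" where "finite {p. c p \<noteq> 0}"
    "\<And>s t. s \<noteq> 0 \<Longrightarrow> t \<noteq> 0 \<Longrightarrow>
      F s t = (\<Sum>p\<in>{p. c p \<noteq> 0}. of_int (c p) * s powi (fst p) * t powi (snd p))"
proof -
  obtain qs where F: "\<And>s t. s \<noteq> 0 \<Longrightarrow> t \<noteq> 0 \<Longrightarrow> F s t = (\<Sum>q\<leftarrow>qs. laurent_monom q s t)"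
    using assms unfolding laurent_def by blast
  define c where "c p = (\<Sum>q\<leftarrow>qs. if snd q = p then fst q else 0)" for p
  define S where "S = snd ` set qs"
  have "c p = 0" if "p \<notin> S" for p
  proof -
    have "map (\<lambda>q. if snd q = p then fst q else 0) qs = map (\<lambda>_. 0) qs"
      using that by (intro map_cong refl) (auto simp: S_def)
    then show ?thesis unfolding c_def by (simp only: sum_list_0)
  qed
  then have sub: "{p. c p \<noteq> 0} \<subseteq> S" by auto
  then have fin: "finite {p. c p \<noteq> 0}"
    by (rule finite_subset) (simp add: S_def)
  have sum: "(\<Sum>q\<leftarrow>rs. laurent_monom q s t)
      = (\<Sum>p\<in>S. of_int (\<Sum>q\<leftarrow>rs. if snd q = p then fst q else 0) * s powi (fst p) * t powi (snd p))"
    if "set rs \<subseteq> set qs" for s t :: 'a and rs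
    using that
  proof (induction rs)
    case (Cons q rs)
    let ?c = "\<lambda>rs p. \<Sum>q\<leftarrow>rs. if snd q = p then fst q else 0" and ?m = "\<lambda>p. s powi (fst p) * t powi (snd p)"
    have "finite S" "snd q \<in> S" using Cons.prems by (auto simp: S_def)
    then have "laurent_monom q s t = (\<Sum>p\<in>S. if snd q = p then of_int (fst q) * ?m p else 0)"
      by (simp add: laurent_monom_def mult.assoc)
    moreover have "(\<Sum>q\<leftarrow>rs. laurent_monom q s t) = (\<Sum>p\<in>S. of_int (?c rs p) * ?m p)"
      using Cons by (simp add: mult.assoc)
    ultimately have "(\<Sum>q\<leftarrow>q # rs. laurent_monom q s t)
        = (\<Sum>p\<in>S. (if snd q = p then of_int (fst q) * ?m p else 0) + of_int (?c rs p) * ?m p)"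
      by (simp only: sum.distrib list.map sum_list.Cons)
    also have "\<dots> = (\<Sum>p\<in>S. of_int (?c (q # rs) p) * s powi (fst p) * t powi (snd p))"
      by (intro sum.cong refl) (simp add: algebra_simps)
    finally show ?case .
  qed simp
  have "F s t = (\<Sum>p\<in>S. of_int (c p) * s powi (fst p) * t powi (snd p))" if "s \<noteq> 0" "t \<noteq> 0" for s t
    unfolding F [OF that] c_def by (rule sum) simp
  moreover have "(\<Sum>p\<in>S. of_int (c p) * s powi (fst p) * t powi (snd p))
      = (\<Sum>p\<in>{p. c p \<noteq> 0}. of_int (c p) * s powi (fst p) * t powi (snd p))" for s t :: 'a
    by (rule sum.mono_neutral_right) (use sub in \<open>auto simp: S_def\<close>)
  ultimately show thesis using that [OF fin] by simp
qed

lemma laurent_RV: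
  assumes "kl \<in> pairs4" "ij \<in> pairs4"
  shows "laurent (\<lambda>s t :: 'a::field. coeff_of (RV_img s t) kl ij)"
    "laurent (\<lambda>s t :: 'a::field. coeff_of (RV_inv_img s t) kl ij)"
proof -
  have "\<forall>ij\<in>pairs4. \<forall>kl\<in>pairs4. laurent (\<lambda>s t :: 'a. coeff_of (RV_img s t) kl ij)"
    unfolding ball_pairs4 coeff_of_def RV_img_def by (simp, intro conjI laurent_intros)
  then show "laurent (\<lambda>s t :: 'a. coeff_of (RV_img s t) kl ij)" using assms by blast
  have "\<forall>ij\<in>pairs4. \<forall>kl\<in>pairs4. laurent (\<lambda>s t :: 'a. coeff_of (RV_inv_img s t) kl ij)"
    unfolding ball_pairs4 coeff_of_def RV_inv_img_def by (simp, intro conjI laurent_intros)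
  then show "laurent (\<lambda>s t :: 'a. coeff_of (RV_inv_img s t) kl ij)" using assms by blast
qed

lemma nth_in_letters: "xs \<in> tbasis n \<Longrightarrow> i < n \<Longrightarrow> xs ! i \<in> letters"
  unfolding tbasis_def letters_def using nth_mem by blast

text \<open>Integrality is read off on the \<open>V_1\<close> side, because the entries of that
  matrix and of its inverse contain no square roots.\<close>

lemma laurent_rhop_RV:
  assumes "braid_word n w" "us \<in> tbasis n" "xs \<in> tbasis n"
  shows "laurent (\<lambda>s t :: 'a::field. ent (rhop (coeff_of (RV_img s t)) (coeff_of (RV_inv_img s t)) w) us xs)"
  using assms(1,2)
proof (induction w arbitrary: us)
  case Nil
  then show ?case by (simp add: ent_one laurent_basic)
next
  case (Cons g w)
  let ?i = "nat \<bar>g\<bar>"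
  have i: "1 \<le> ?i" "?i < n" and w: "braid_word n w" using Cons.prems by simp_all
  have n: "length xs = n" using assms(3) by (simp add: tbasis_def)
  have "laurent (\<lambda>s t :: 'a. ent (genop (if g > 0 then coeff_of (RV_img s t) else coeff_of (RV_inv_img s t)) ?i) us zs)"
    if zs: "zs \<in> tbasis n" for zs
  proof -
    have "(us ! (?i - 1), us ! ?i) \<in> pairs4" "(zs ! (?i - 1), zs ! ?i) \<in> pairs4"
      using zs Cons.prems(2) i by (simp_all add: pairs4_letters nth_in_letters)
    then show ?thesis
      unfolding ent_genop [OF i Cons.prems(2) zs] gen_op_def
      by (cases "g > 0") (auto intro!: laurent_if laurent_RV laurent_basic(1))
  qed
  then show ?case
    using Cons.IH [OF w] by (simp add: ent_times n laurent_sum laurent_mult)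
qed

text \<open>Links enter as closures of braid words. The coefficients \<open>c\<close> are chosen
  before \<open>a\<close>, \<open>b\<close> and \<open>y\<close>, so one Laurent polynomial
  describes both invariants at all admissible parameters.\<close>

theorem theorem1p1:
  fixes n :: nat and w :: "int list"
  assumes "n \<ge> 1" and "braid_word n w"
  shows "\<exists>c :: int \<times> int \<Rightarrow> int. finite {p. c p \<noteq> 0} \<and>
    (\<forall>(a :: 'a :: field_char_0) b y. a \<noteq> 0 \<longrightarrow> b \<noteq> 0 \<longrightarrow> y^2 = (a^2 - 1) * (1 - b^2) \<longrightarrow>
       V1_inv (a^2) (b^2) n w = LG_inv a b y n w \<and>
       LG_inv a b y n w = (\<Sum>p\<in>{p. c p \<noteq> 0}. of_int (c p) * (a^2) powi (fst p) * (b^2) powi (snd p)))"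
proof -
  obtain m where m: "n = Suc m" using assms(1) by (cases n) auto
  let ?A = "\<lambda>s t :: 'a. rhop (coeff_of (RV_img s t)) (coeff_of (RV_inv_img s t)) w"
  let ?F = "\<lambda>s t :: 'a. tr m (dg hV * blk 1 1 (?A s t))"
  have V: "V1_inv s t n w = ?F s t" if st: "s \<noteq> 0" "t \<noteq> 0" for s t :: 'a
  proof -
    have "V1_inv s t n w = markov_trace hV n (?A s t) / 4"
      unfolding V1_inv_def by (rule braid_invariant_markov_trace [OF assms(2) Rinv4_RV [OF st] assms(1)])
    also have "\<dots> = (\<Sum>x\<in>letters. tr m (dg hV * blk x x (?A s t))) / 4"
      by (simp only: m markov_trace_Suc)
    also have "(\<Sum>x\<in>letters. tr m (dg hV * blk x x (?A s t))) = (\<Sum>x\<in>letters. ?F s t)"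
      by (intro sum.cong refl partial_trace_RV_scalar [OF st assms(2)])
    \<comment> \<open>The four equal partial traces cancel the division by 4, which is nonzero in
      characteristic 0; no denominator remains.\<close>
    also have "\<dots> / 4 = ?F s t"
      by (simp add: letters_def)
    finally show ?thesis .
  qed
  have h: "laurent (\<lambda>s t :: 'a. prod_list (map hV xs))" for xs
  proof (induction xs)
    case (Cons x xs)
    have "laurent (\<lambda>s t :: 'a. hV x)"
      using laurent_of_int [of "-1", where ?'a = 'a] laurent_basic(1,2) [where ?'a = 'a] by (simp add: hV_def)
    then show ?case using laurent_mult Cons by simp
  qed (simp add: laurent_basic)
  have "laurent (\<lambda>s t. \<Sum>xs\<in>tbasis m. prod_list (map hV xs) * ent (?A s t) (1 # xs) (1 # xs))"
    using assms(2) m by (intro laurent_sum laurent_mult h laurent_rhop_RV [of n]) (simp_all add: Cons_in_tbasis)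
  moreover have "?F s t = (\<Sum>xs\<in>tbasis m. prod_list (map hV xs) * ent (?A s t) (1 # xs) (1 # xs))" for s t
    unfolding tr_def by (intro sum.cong refl) (simp add: ent_dg_times)
  ultimately have "laurent ?F" by simp
  then obtain c :: "int \<times> int \<Rightarrow> int" where c: "finite {p. c p \<noteq> 0}"
    "\<And>s t. s \<noteq> 0 \<Longrightarrow> t \<noteq> 0 \<Longrightarrow>
      ?F s t = (\<Sum>p\<in>{p. c p \<noteq> 0}. of_int (c p) * s powi (fst p) * t powi (snd p))"
    by (rule laurent_coefficients) blast
  show ?thesis
  proof (intro exI [of _ c] conjI c(1) allI impI)
    fix a b y :: 'a
    assume ab: "a \<noteq> 0" "b \<noteq> 0" and y: "y^2 = (a^2 - 1) * (1 - b^2)"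
    show eq: "V1_inv (a^2) (b^2) n w = LG_inv a b y n w"
      by (rule V1_inv_eq_LG_inv [OF assms ab y])
    show "LG_inv a b y n w = (\<Sum>p\<in>{p. c p \<noteq> 0}. of_int (c p) * (a^2) powi (fst p) * (b^2) powi (snd p))"
      unfolding eq [symmetric] using V c(2) ab by simp
  qed
qed

end
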